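(* Let $F$ be a connected, checkerboard coloured, $4$-regular graph cellularly embedded in the sphere, the torus, or the real projective plane, and let $s$ be a graph state of $F$ without crossings. Identify the edges of both Tait graphs $F_{bl}$ and $F_{wh}$ with the vertices of $F$, and let $B$ (resp. $W$) be the set of edges corresponding to vertices of $F$ at which $s$ has a black split (resp. white split). Then the number of components of $s$ equals \[ \min\{\,f_{F_{bl}}(W)+\gamma_{F_{wh}}(B),\; f_{F_{bl}}(W)+\gamma_{F_{bl}}(W)\,\}. \]
   Context: A checkerboard colouring of $F$ colours its faces black and white so that adjacent faces differ; at each vertex of $F$ the four face-corners alternate black, white, black, white. A vertex state at $v$ pairs the four half-edges at $v$: the black split pairs the two half-edges bounding each black corner; the white split pairs those bounding each white corner; the crossing pairs opposite half-edges. A graph state is a choice of vertex state at every vertex; its components are the resulting closed curves. The blackface graph $F_{bl}$ has a vertex in each black face and, for each vertex $v$ of $F$, an edge through $v$ joining the black faces meeting at $v$; the whiteface graph $F_{wh}$ is defined analogously with white faces. Both are viewed as ribbon graphs (cellularly embedded graphs), and $F$ is the medial graph of each. For a ribbon graph $H$ and $A\subseteq E(H)$, $f_H(A)$ and $\gamma_H(A)$ are the number of boundary components and the Euler genus of the spanning ribbon subgraph $(V(H),A)$. *)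

theory Defs
  imports Main
begin

text \<open>
  Finite cellularly embedded graphs (equivalently, ribbon graphs) on arbitrary, possibly
  non-orientable, closed surfaces are encoded by their flags. A flag is an incident triple of
  vertex, edge and face, where the two ends and the two sides of an edge are told apart, so every
  edge carries four flags. The operations flipV, flipE and flipF pass to the flag that differs in
  the vertex, the edge or the face only.

  In the ribbon graph, a flag is a point on the boundary of a vertex disc where an edge ribbon
  begins or ends: flipF moves along the segment to which the ribbon is attached, flipE moves along
  the piece of the disc boundary up to the next ribbon, flipV moves along the side of the ribbon.

  Isolated vertices carry no flags and cannot be encoded as part of a graph, but they do occur
  below as components of spanning subgraphs (which keep all flags of the big graph).
\<close>

record 'f flag_graph =
  flags :: "'f set"
  flipV :: "'f \<Rightarrow> 'f"
  flipE :: "'f \<Rightarrow> 'f"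
  flipF :: "'f \<Rightarrow> 'f"

definition embedded_graph :: "'f flag_graph \<Rightarrow> bool" where
  "embedded_graph H \<longleftrightarrow>
     finite (flags H) \<and>
     (\<forall>g \<in> {flipV H, flipE H, flipF H}. \<forall>x \<in> flags H.
        g x \<in> flags H \<and> g (g x) = x \<and> g x \<noteq> x) \<and>
     (\<forall>x \<in> flags H. flipV H (flipF H x) = flipF H (flipV H x) \<and> flipV H x \<noteq> flipF H x)"

definition conn_classes :: "'a set \<Rightarrow> ('a \<times> 'a) set \<Rightarrow> 'a set set" where
  "conn_classes D r = D // ((r \<union> r\<inverse>) \<inter> D \<times> D)\<^sup>*"

definition orbits :: "'a set \<Rightarrow> ('a \<Rightarrow> 'a) set \<Rightarrow> 'a set set" where
  "orbits D G = conn_classes D {(x, g x) | x g. x \<in> D \<and> g \<in> G}"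

text \<open>Vertices, edges and faces are identified with their sets of flags.\<close>

definition verts :: "'f flag_graph \<Rightarrow> 'f set set" where
  "verts H = orbits (flags H) {flipE H, flipF H}"

definition edges :: "'f flag_graph \<Rightarrow> 'f set set" where
  "edges H = orbits (flags H) {flipV H, flipF H}"

definition faces :: "'f flag_graph \<Rightarrow> 'f set set" where
  "faces H = orbits (flags H) {flipV H, flipE H}"

definition half_edge :: "'f flag_graph \<Rightarrow> 'f \<Rightarrow> 'f set" where
  "half_edge H x = {x, flipF H x}"

definition degree :: "'f flag_graph \<Rightarrow> 'f set \<Rightarrow> nat" where
  "degree H v = card (half_edge H ` v)"

definition four_regular :: "'f flag_graph \<Rightarrow> bool" where
  "four_regular H \<longleftrightarrow> (\<forall>v \<in> verts H. degree H v = 4)"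

definition connected_graph :: "'f flag_graph \<Rightarrow> bool" where
  "connected_graph H \<longleftrightarrow> card (orbits (flags H) {flipV H, flipE H, flipF H}) = 1"


text \<open>
  The surface of a connected embedded graph is given, up to homeomorphism, by its Euler
  characteristic and orientability. It is orientable iff the flags can be given two signs such
  that every flip changes the sign.
\<close>

definition euler_char :: "'f flag_graph \<Rightarrow> int" where
  "euler_char H = int (card (verts H)) - int (card (edges H)) + int (card (faces H))"

definition orientable :: "'f flag_graph \<Rightarrow> bool" where
  "orientable H \<longleftrightarrow>
     (\<exists>pos. \<forall>g \<in> {flipV H, flipE H, flipF H}. \<forall>x \<in> flags H. g x \<in> pos \<longleftrightarrow> x \<notin> pos)"

definition in_sphere :: "'f flag_graph \<Rightarrow> bool" where
  "in_sphere H \<longleftrightarrow> orientable H \<and> euler_char H = 2"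

definition in_torus :: "'f flag_graph \<Rightarrow> bool" where
  "in_torus H \<longleftrightarrow> orientable H \<and> euler_char H = 0"

definition in_projective_plane :: "'f flag_graph \<Rightarrow> bool" where
  "in_projective_plane H \<longleftrightarrow> \<not> orientable H \<and> euler_char H = 1"


text \<open>
  Spanning ribbon subgraphs \<open>(V(H), A)\<close> with \<open>A \<subseteq> edges H\<close>. Their boundary runs along the sides
  of the ribbons in \<open>A\<close>, and along the vertex disc where a ribbon not in \<open>A\<close> has been removed.
  The Euler genus of a surface with \<open>k\<close> components and \<open>f\<close> boundary components is the sum of those
  of the components, i.e. \<open>2k - f\<close> minus its Euler characteristic, which is \<open>|V(H)| - |A|\<close>.
\<close>

definition boundary_comps :: "'f flag_graph \<Rightarrow> 'f set set \<Rightarrow> 'f set set" where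
  "boundary_comps H A =
     orbits (flags H) {flipE H, \<lambda>x. if x \<in> \<Union>A then flipV H x else flipF H x}"

definition subgraph_comps :: "'f flag_graph \<Rightarrow> 'f set set \<Rightarrow> 'f set set" where
  "subgraph_comps H A =
     orbits (flags H) {flipE H, flipF H, \<lambda>x. if x \<in> \<Union>A then flipV H x else x}"

definition euler_genus :: "'f flag_graph \<Rightarrow> 'f set set \<Rightarrow> int" where
  "euler_genus H A =
     2 * int (card (subgraph_comps H A)) - int (card (boundary_comps H A))
       - (int (card (verts H)) - int (card A))"


definition checkerboard :: "'f flag_graph \<Rightarrow> 'f set set \<Rightarrow> bool" where
  "checkerboard F black \<longleftrightarrow> black \<subseteq> faces F \<and>
     (\<forall>f \<in> faces F. \<forall>g \<in> faces F. \<forall>x \<in> f. flipF F x \<in> g \<longrightarrow> (f \<in> black \<longleftrightarrow> g \<notin> black))"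

text \<open>
  The graph with a vertex in each face of a colour class \<open>C\<close> and an edge through each vertex of
  \<open>F\<close>, for checkerboard coloured 4-regular \<open>F\<close>. Its flags are the flags of \<open>F\<close> in the faces in
  \<open>C\<close>. The corner \<open>{x, flipE F x}\<close> of such a face is where an end of the new edge lies, with \<open>x\<close> on
  one side of it. Hence the other side is \<open>flipE F x\<close>; the next edge end on the face is found along
  the edge of \<open>F\<close>; and the other end of the new edge, on the same side, is found in the opposite
  corner by crossing the half-edge at \<open>x\<close>, the adjacent corner of the other colour, and the
  following half-edge.
\<close>

definition face_graph :: "'f flag_graph \<Rightarrow> 'f set set \<Rightarrow> 'f flag_graph" where
  "face_graph F C =
     \<lparr> flags = flags F \<inter> \<Union>C,
       flipV = (\<lambda>x. flipF F (flipE F (flipF F x))),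
       flipE = flipV F,
       flipF = flipE F \<rparr>"

definition blackface_graph :: "'f flag_graph \<Rightarrow> 'f set set \<Rightarrow> 'f flag_graph" where
  "blackface_graph F black = face_graph F black"

definition whiteface_graph :: "'f flag_graph \<Rightarrow> 'f set set \<Rightarrow> 'f flag_graph" where
  "whiteface_graph F black = face_graph F (faces F - black)"

text \<open>The edge of \<open>H = face_graph F C\<close> through the vertex \<open>v\<close> of \<open>F\<close> consists of those flags at
  \<open>v\<close> that are flags of \<open>H\<close>.\<close>

definition edges_through :: "'f flag_graph \<Rightarrow> 'f set set \<Rightarrow> 'f set set" where
  "edges_through H X = (\<lambda>v. v \<inter> flags H) ` X"


datatype vertex_state = Black_Split | White_Split | Crossing

fun state_pairing ::
  "'f flag_graph \<Rightarrow> 'f set set \<Rightarrow> 'f set \<Rightarrow> vertex_state \<Rightarrow> ('f set \<times> 'f set) set" where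
  "state_pairing F black v Black_Split =
     {(half_edge F x, half_edge F (flipE F x)) | x. x \<in> v \<and> x \<in> \<Union>black}"
| "state_pairing F black v White_Split =
     {(half_edge F x, half_edge F (flipE F x)) | x. x \<in> v \<and> x \<in> \<Union>(faces F - black)}"
| "state_pairing F black v Crossing =
     {(half_edge F x, half_edge F (flipE F (flipF F (flipE F x)))) | x. x \<in> v}"

text \<open>A closed curve of a graph state is identified with the set of half-edges it traverses.\<close>

definition state_comps ::
  "'f flag_graph \<Rightarrow> 'f set set \<Rightarrow> ('f set \<Rightarrow> vertex_state) \<Rightarrow> 'f set set set" where
  "state_comps F black s =
     conn_classes (half_edge F ` flags F)
       ({(half_edge F x, half_edge F (flipV F x)) | x. x \<in> flags F} \<union>
        (\<Union>v \<in> verts F. state_pairing F black v (s v)))"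

end

theory Submission
  imports Defs
begin

text \<open>
  The curves of the state separate the surface of \<open>F\<close> into the ribbon subgraphs \<open>(V(F_bl), W)\<close> and
  \<open>(V(F_wh), B)\<close>, and they are the boundary components of both. Since gluing the pieces along the
  curves gives a connected surface, the Euler genera of the two ribbon subgraphs add up to at most
  the Euler genus of the surface. Euler genera are nonnegative, and even for orientable ribbon
  graphs; so on the sphere, the torus and the projective plane one of the two vanishes.
\<close>

section \<open>Connectivity classes of a relation\<close>

text \<open>All counts are numbers of classes of arcs on flags, and \<open>euler_genus\<close> is
  only a formula in such counts. Its nonnegativity and parity therefore have to be proved by adding
  ribbons one at a time, where the hard part is to know how the boundary curve pieces connect the
  four flags of the new ribbon. Parity of path ends decides this. A white split runs along the white
  corners and so opens a passage between the two black ones: the black ribbon is kept and the white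
  one is cut. This is why \<open>W\<close> belongs to \<open>F_bl\<close> and \<open>B\<close> to
  \<open>F_wh\<close>. The genera add up to an inequality only. Consider the graph whose nodes are
  the pieces and whose edges are the curves: it is connected, and twice its cycle rank is the
  defect. Its connectedness alone is used, as (number of pieces) \<open>\<le>\<close> (number of
  curves) + 1. Parity is what settles the torus: a sum of at most 2 would still allow two genera
  equal to 1, as the bounds do on the Klein bottle.\<close>

definition conn :: "'a set \<Rightarrow> ('a \<times> 'a) set \<Rightarrow> ('a \<times> 'a) set" where
  "conn D r = ((r \<union> r\<inverse>) \<inter> D \<times> D)\<^sup>* \<inter> D \<times> D"

lemma equiv_conn: "equiv D (conn D r)"
proof -
  let ?s = "(r \<union> r\<inverse>) \<inter> D \<times> D"
  have "sym ?s" by (auto simp: sym_def)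
  then have s: "sym (?s\<^sup>*)" by (rule sym_rtrancl)
  show ?thesis
    unfolding conn_def equiv_def
    using s by (auto simp: refl_on_def sym_def trans_def intro: rtrancl_trans)
qed

lemma conn_subset: "conn D r \<subseteq> D \<times> D"
  by (auto simp: conn_def)

lemma conn_refl: "x \<in> D \<Longrightarrow> (x, x) \<in> conn D r"
  by (auto simp: conn_def)

lemma conn_sym: "(x, y) \<in> conn D r \<Longrightarrow> (y, x) \<in> conn D r"
  using equiv_conn[of D r] by (auto simp: equiv_def sym_def)

lemma conn_trans: "(x, y) \<in> conn D r \<Longrightarrow> (y, z) \<in> conn D r \<Longrightarrow> (x, z) \<in> conn D r"
  using equiv_conn[of D r] unfolding equiv_def trans_def by blast

lemma conn_edge: "(x, y) \<in> r \<Longrightarrow> x \<in> D \<Longrightarrow> y \<in> D \<Longrightarrow> (x, y) \<in> conn D r"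
  by (auto simp: conn_def)

lemma conn_least:
  assumes "equiv D Q" and "\<And>x y. (x, y) \<in> r \<Longrightarrow> x \<in> D \<Longrightarrow> y \<in> D \<Longrightarrow> (x, y) \<in> Q"
  shows "conn D r \<subseteq> Q"
proof -
  have sym: "\<And>x y. (x, y) \<in> Q \<Longrightarrow> (y, x) \<in> Q"
    and trans: "\<And>x y z. (x, y) \<in> Q \<Longrightarrow> (y, z) \<in> Q \<Longrightarrow> (x, z) \<in> Q"
    and refl: "\<And>x. x \<in> D \<Longrightarrow> (x, x) \<in> Q"
    using assms(1) unfolding equiv_def sym_def trans_def refl_on_def by blast+
  have "(x, y) \<in> Q" if "(x, y) \<in> ((r \<union> r\<inverse>) \<inter> D \<times> D)\<^sup>*" "x \<in> D" for x y
    using that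
  proof (induction rule: rtrancl_induct)
    case base
    then show ?case by (rule refl)
  next
    case (step y z)
    then show ?case using assms(2) sym trans by blast
  qed
  then show ?thesis by (auto simp: conn_def)
qed

lemma conn_mono:
  assumes "\<And>x y. (x, y) \<in> r \<Longrightarrow> x \<in> D \<Longrightarrow> y \<in> D \<Longrightarrow> (x, y) \<in> conn D r'"
  shows "conn D r \<subseteq> conn D r'"
  using conn_least[OF equiv_conn] assms by blast

lemma conn_cong:
  assumes "\<And>x y. (x, y) \<in> r \<Longrightarrow> x \<in> D \<Longrightarrow> y \<in> D \<Longrightarrow> (x, y) \<in> conn D r'"
    and "\<And>x y. (x, y) \<in> r' \<Longrightarrow> x \<in> D \<Longrightarrow> y \<in> D \<Longrightarrow> (x, y) \<in> conn D r"
  shows "conn D r = conn D r'"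
  using conn_mono[of r D r'] conn_mono[of r' D r] assms by blast

text \<open>The closure inside \<open>conn_classes\<close> is reflexive on the whole type, hence not
  an equivalence on \<open>D\<close> in the sense of \<open>equiv\<close>. Chains that start in
  \<open>D\<close> stay in \<open>D\<close>, so the restriction \<open>conn\<close> has the same
  classes there.\<close>

lemma conn_classes_conn: "conn_classes D r = D // conn D r"
proof -
  have "y \<in> D" if "(x, y) \<in> ((r \<union> r\<inverse>) \<inter> D \<times> D)\<^sup>*" "x \<in> D" for x y
    using that by (induction rule: rtrancl_induct) auto
  then have "((r \<union> r\<inverse>) \<inter> D \<times> D)\<^sup>* `` {x} = conn D r `` {x}" if "x \<in> D" for x
    using that by (auto simp: conn_def)
  then show ?thesis
    unfolding conn_classes_def quotient_def by auto
qed

lemma finite_conn_classes: "finite D \<Longrightarrow> finite (conn_classes D r)"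
  unfolding conn_classes_conn by (rule finite_quotient[OF _ conn_subset])

lemma conn_classes_nonempty: "C \<in> conn_classes D r \<Longrightarrow> C \<noteq> {}"
  unfolding conn_classes_conn by (rule in_quotient_imp_non_empty[OF equiv_conn])

lemma Union_conn_classes: "\<Union>(conn_classes D r) = D"
  unfolding conn_classes_conn by (rule Union_quotient[OF equiv_conn])

lemma conn_classes_disjoint:
  "C \<in> conn_classes D r \<Longrightarrow> C' \<in> conn_classes D r \<Longrightarrow> x \<in> C \<Longrightarrow> x \<in> C' \<Longrightarrow> C = C'"
  unfolding conn_classes_conn using quotient_disj[OF equiv_conn] by blast

lemma conn_classes_eq_class: "C \<in> conn_classes D r \<Longrightarrow> x \<in> C \<Longrightarrow> C = conn D r `` {x}"
  unfolding conn_classes_conn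
  by (elim quotientE) (simp add: equiv_class_eq[OF equiv_conn])

lemma conn_class_in: "x \<in> D \<Longrightarrow> conn D r `` {x} \<in> conn_classes D r"
  unfolding conn_classes_conn by (rule quotientI)

lemma conn_classes_closed:
  "C \<in> conn_classes D r \<Longrightarrow> x \<in> C \<Longrightarrow> (x, y) \<in> conn D r \<Longrightarrow> y \<in> C"
  by (metis conn_classes_eq_class Image_singleton_iff)

lemma card_quotient_transport:
  assumes "equiv D R" "equiv D' R'" "h ` D = D'"
    and iff: "\<And>x y. x \<in> D \<Longrightarrow> y \<in> D \<Longrightarrow> (x, y) \<in> R \<longleftrightarrow> (h x, h y) \<in> R'"
  shows "card (D // R) = card (D' // R')"
proof (rule bij_betw_same_card[of "(`) h"])
  have R: "R \<subseteq> D \<times> D" and R': "R' \<subseteq> D' \<times> D'"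
    using assms(1,2) by (auto simp: equiv_type)
  have im: "h ` (R `` {x}) = R' `` {h x}" if "x \<in> D" for x
  proof
    show "h ` (R `` {x}) \<subseteq> R' `` {h x}" using iff that R by auto
    show "R' `` {h x} \<subseteq> h ` (R `` {x})"
    proof
      fix z assume z: "z \<in> R' `` {h x}"
      then obtain y where "y \<in> D" "z = h y" using R' assms(3) by blast
      then show "z \<in> h ` (R `` {x})" using z iff[OF that] by blast
    qed
  qed
  show "bij_betw ((`) h) (D // R) (D' // R')"
  proof (rule bij_betw_imageI)
    show "inj_on ((`) h) (D // R)"
    proof (rule inj_onI)
      fix X Y assume X: "X \<in> D // R" and Y: "Y \<in> D // R" and eq: "h ` X = h ` Y"
      obtain x y where xy: "x \<in> D" "X = R `` {x}" "y \<in> D" "Y = R `` {y}"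
        using X Y by (auto elim!: quotientE)
      then have "R' `` {h x} = R' `` {h y}" using eq im by simp
      then have "(h x, h y) \<in> R'"
        using assms(2,3) xy by (metis eq_equiv_class imageI)
      then have "(x, y) \<in> R" using iff xy by blast
      then show "X = Y" using xy assms(1) by (metis equiv_class_eq)
    qed
    show "(`) h ` (D // R) = D' // R'"
    proof
      show "(`) h ` (D // R) \<subseteq> D' // R'"
        using im assms(3) by (auto elim!: quotientE intro!: quotientI)
      show "D' // R' \<subseteq> (`) h ` (D // R)"
      proof
        fix Y assume "Y \<in> D' // R'"
        then obtain y where "y \<in> D'" "Y = R' `` {y}" by (auto elim: quotientE)
        then obtain x where "x \<in> D" "Y = R' `` {h x}" using assms(3) by auto
        then show "Y \<in> (`) h ` (D // R)" using im by (metis quotientI imageI)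
      qed
    qed
  qed
qed

text \<open>Pulling \<open>conn D' r'\<close> back along \<open>h\<close> gives an equivalence on
  \<open>D\<close>, so by minimality it suffices to look at single arcs.\<close>

lemma conn_map:
  assumes "(x, y) \<in> conn D r" and "h ` D \<subseteq> D'"
    and "\<And>x y. (x, y) \<in> r \<Longrightarrow> x \<in> D \<Longrightarrow> y \<in> D \<Longrightarrow> (h x, h y) \<in> conn D' r'"
  shows "(h x, h y) \<in> conn D' r'"
proof -
  have "equiv D {(x, y). x \<in> D \<and> y \<in> D \<and> (h x, h y) \<in> conn D' r'}"
    unfolding equiv_def refl_on_def sym_def trans_def
    using assms(2) by (auto intro: conn_sym conn_trans conn_refl)
  then have "conn D r \<subseteq> {(x, y). x \<in> D \<and> y \<in> D \<and> (h x, h y) \<in> conn D' r'}"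
    by (rule conn_least) (use assms(3) in blast)
  then show ?thesis using assms(1) by blast
qed

lemma card_conn_classes_transport:
  assumes "h ` D \<subseteq> D'" "k ` D' \<subseteq> D"
    and "\<And>x. x \<in> D \<Longrightarrow> k (h x) = x" and "\<And>y. y \<in> D' \<Longrightarrow> h (k y) = y"
    and h: "\<And>x y. (x, y) \<in> r \<Longrightarrow> x \<in> D \<Longrightarrow> y \<in> D \<Longrightarrow> (h x, h y) \<in> conn D' r'"
    and k: "\<And>x y. (x, y) \<in> r' \<Longrightarrow> x \<in> D' \<Longrightarrow> y \<in> D' \<Longrightarrow> (k x, k y) \<in> conn D r"
  shows "card (conn_classes D r) = card (conn_classes D' r')"
  unfolding conn_classes_conn
proof (rule card_quotient_transport[OF equiv_conn equiv_conn])
  show "h ` D = D'" using assms(1,2,4) by force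
  show "(x, y) \<in> conn D r \<longleftrightarrow> (h x, h y) \<in> conn D' r'" if "x \<in> D" "y \<in> D" for x y
    using conn_map[OF _ assms(1) h] conn_map[OF _ assms(2) k, where x="h x" and y="h y"]
      assms(3) that by metis
qed

text \<open>A chain that uses the new arc several times can be shortened to one that uses it at most
  once, in one of two directions.\<close>

lemma conn_insert:
  assumes "a \<in> D" "b \<in> D"
  shows "conn D (insert (a, b) r) = conn D r
    \<union> {(x, y). (x, a) \<in> conn D r \<and> (b, y) \<in> conn D r}
    \<union> {(x, y). (x, b) \<in> conn D r \<and> (a, y) \<in> conn D r}" (is "?L = ?R")
proof
  have "equiv D ?R"
    unfolding equiv_def
  proof (intro conjI)
    show "refl_on D ?R" by (auto simp: refl_on_def intro: conn_refl)
    show "sym ?R" by (auto simp: sym_def intro: conn_sym)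
    show "trans ?R" unfolding trans_def by (blast intro: conn_trans conn_sym)
    show "?R \<subseteq> D \<times> D" using conn_subset[of D r] by blast
  qed
  then show "?L \<subseteq> ?R"
    by (rule conn_least) (auto intro: conn_edge conn_refl)
  have sub: "conn D r \<subseteq> ?L" by (rule conn_mono) (auto intro: conn_edge)
  have ab: "(a, b) \<in> ?L" using assms by (auto intro: conn_edge)
  have "(x, y) \<in> ?L" if "(x, a) \<in> conn D r" "(b, y) \<in> conn D r" for x y
    using that[THEN subsetD[OF sub]] by (rule conn_trans[OF conn_trans[OF _ ab]])
  then have "(x, y) \<in> ?L" if "(x, a) \<in> conn D r \<and> (b, y) \<in> conn D r \<or>
      (x, b) \<in> conn D r \<and> (a, y) \<in> conn D r" for x y
    using that conn_sym by metis
  then show "?R \<subseteq> ?L" using sub by auto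
qed

lemma conn_insert_redundant:
  "(a, b) \<in> conn D r \<Longrightarrow> conn D (insert (a, b) r) = conn D r"
  by (rule conn_cong) (auto intro: conn_edge)

text \<open>Exactly the classes of \<open>a\<close> and \<open>b\<close> merge, and all others
  survive.\<close>

lemma card_conn_classes_insert:
  assumes "finite D" "a \<in> D" "b \<in> D" "(a, b) \<notin> conn D r"
  shows "card (conn_classes D r) = Suc (card (conn_classes D (insert (a, b) r)))"
proof -
  let ?R = "conn D r" and ?R' = "conn D (insert (a, b) r)"
  let ?A = "?R `` {a}" and ?B = "?R `` {b}"
  let ?rest = "D // ?R - {?A, ?B}"
  have cls: "?R' `` {x} = (if x \<in> ?A \<union> ?B then ?A \<union> ?B else ?R `` {x})" if "x \<in> D" for x
    unfolding conn_insert[OF assms(2,3)] by (auto intro: conn_trans conn_sym)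
  have ne: "?A \<noteq> ?B" using assms by (metis eq_equiv_class equiv_conn)
  have eq: "D // ?R' = insert (?A \<union> ?B) ?rest"
  proof
    show "D // ?R' \<subseteq> insert (?A \<union> ?B) ?rest"
    proof
      fix X assume "X \<in> D // ?R'"
      then obtain x where x: "x \<in> D" "X = ?R' `` {x}" by (auto elim: quotientE)
      have "?R `` {x} \<noteq> ?A" "?R `` {x} \<noteq> ?B" if "x \<notin> ?A \<union> ?B"
        using that conn_refl[OF x(1)] by blast+
      then show "X \<in> insert (?A \<union> ?B) ?rest"
        using x cls[OF x(1)] by (auto intro: quotientI)
    qed
    show "insert (?A \<union> ?B) ?rest \<subseteq> D // ?R'"
    proof
      fix X assume "X \<in> insert (?A \<union> ?B) ?rest"
      then consider "X = ?A \<union> ?B" | "X \<in> ?rest" by blast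
      then show "X \<in> D // ?R'"
      proof cases
        case 1
        then have "X = ?R' `` {a}"
          using cls[OF assms(2)] conn_refl[OF assms(2), of r] by auto
        then show ?thesis using assms(2) by (simp add: quotientI)
      next
        case 2
        then obtain x where x: "x \<in> D" "X = ?R `` {x}" by (auto elim: quotientE)
        have "x \<notin> ?A \<union> ?B" using 2 x by (auto dest: equiv_class_eq[OF equiv_conn])
        then have "X = ?R' `` {x}" using cls x by simp
        then show ?thesis using x by (simp add: quotientI)
      qed
    qed
  qed
  have notin: "?A \<union> ?B \<notin> ?rest"
  proof
    assume "?A \<union> ?B \<in> ?rest"
    then have "?A \<union> ?B \<in> conn_classes D r" "?A \<union> ?B \<noteq> ?A"
      by (auto simp: conn_classes_conn)
    moreover have "a \<in> ?A \<union> ?B" using conn_refl[OF assms(2)] by auto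
    ultimately show False using conn_classes_eq_class by metis
  qed
  have fin: "finite (D // ?R)" using assms(1) finite_conn_classes[of D r] by (simp add: conn_classes_conn)
  have sub: "{?A, ?B} \<subseteq> D // ?R" using assms(2,3) by (auto intro: quotientI)
  have "card (D // ?R) = card ?rest + 2"
    using card_Diff_subset[OF _ sub] card_mono[OF fin sub] ne by auto
  moreover have "card (D // ?R') = Suc (card ?rest)"
    unfolding eq using fin notin by simp
  ultimately show ?thesis by (simp add: conn_classes_conn)
qed

text \<open>Think of two separate paths with ends \<open>p\<close>, \<open>q\<close> and
  \<open>p'\<close>, \<open>q'\<close>. Closing each path by itself gives two cycles; joining the
  paths crosswise gives one. This is the local change of the boundary when a ribbon is
  inserted.\<close>

lemma card_conn_classes_repair:
  assumes "finite D" "p \<in> D" "q \<in> D" "p' \<in> D" "q' \<in> D"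
    and "(p, q) \<in> conn D r" "(p', q') \<in> conn D r" "(p, p') \<notin> conn D r"
  shows "card (conn_classes D (insert (p, q) (insert (p', q') r))) =
    Suc (card (conn_classes D (insert (p, p') (insert (q, q') r))))"
proof -
  have 1: "conn D (insert (p, q) (insert (p', q') r)) = conn D r"
    by (rule conn_cong) (use assms in \<open>auto intro: conn_edge\<close>)
  have 2: "conn D (insert (p, p') (insert (q, q') r)) = conn D (insert (p, p') r)"
  proof (rule conn_cong)
    fix x y assume xy: "(x, y) \<in> insert (p, p') (insert (q, q') r)" "x \<in> D" "y \<in> D"
    have sub: "conn D r \<subseteq> conn D (insert (p, p') r)" by (rule conn_mono) (auto intro: conn_edge)
    have "(p, p') \<in> conn D (insert (p, p') r)" using assms by (auto intro: conn_edge)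
    then have "(q, q') \<in> conn D (insert (p, p') r)"
      using sub assms by (meson conn_sym conn_trans subsetD)
    then show "(x, y) \<in> conn D (insert (p, p') r)" using xy by (auto intro: conn_edge)
  qed (auto intro: conn_edge)
  show ?thesis
    unfolding conn_classes_conn 1 2
    using card_conn_classes_insert[of D p p' r] assms by (simp add: conn_classes_conn)
qed

lemma card_conn_classes_le_Suc_insert:
  assumes "finite D"
  shows "card (conn_classes D r) \<le> Suc (card (conn_classes D (insert (a, b) r)))"
proof -
  consider "a \<in> D \<and> b \<in> D \<and> (a, b) \<notin> conn D r" | "(a, b) \<in> conn D r" | "a \<notin> D \<or> b \<notin> D" by blast
  then show ?thesis
  proof cases
    case 1
    then show ?thesis using card_conn_classes_insert[OF assms] by auto
  next
    case 2
    then show ?thesis by (simp add: conn_classes_conn conn_insert_redundant)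
  next
    case 3
    then have "conn D (insert (a, b) r) = conn D r"
      by (intro conn_cong) (auto intro: conn_edge)
    then show ?thesis by (simp add: conn_classes_conn)
  qed
qed

lemma card_conn_classes_le_Un:
  assumes "finite D" "finite r'"
  shows "card (conn_classes D r) \<le> card (conn_classes D (r \<union> r')) + card r'"
  using assms(2)
proof (induction r' rule: finite_induct)
  case empty
  then show ?case by simp
next
  case (insert e r')
  obtain a b where "e = (a, b)" by (cases e)
  then show ?case
    using insert card_conn_classes_le_Suc_insert[OF assms(1), of "r \<union> r'" a b] by simp
qed

text \<open>The forest bound: without arcs all classes are singletons, and each arc merges at most
  one pair of classes.\<close>

lemma card_le_conn_classes_plus_edges:
  assumes "finite D" "finite r"
  shows "card D \<le> card (conn_classes D r) + card r"
proof -
  have "conn D {} = Id_on D" by (auto simp: conn_def)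
  then have "conn_classes D {} = (\<lambda>x. {x}) ` D"
    unfolding conn_classes_conn quotient_def by auto
  then have "card (conn_classes D {}) = card D" by (simp add: card_image)
  then show ?thesis using card_conn_classes_le_Un[OF assms, of "{}"] by simp
qed

text \<open>Every class of the coarser relation is the saturation of a class of the finer
  one.\<close>

lemma card_conn_classes_antimono:
  assumes "finite D" "conn D r \<subseteq> conn D r'"
  shows "card (conn_classes D r') \<le> card (conn_classes D r)"
proof (rule surj_card_le)
  show "finite (conn_classes D r)" using assms(1) by (rule finite_conn_classes)
  show "conn_classes D r' \<subseteq> (\<lambda>C. conn D r' `` C) ` conn_classes D r"
  proof
    fix X assume "X \<in> conn_classes D r'"
    then obtain x where x: "x \<in> D" "X = conn D r' `` {x}"
      unfolding conn_classes_conn by (auto elim: quotientE)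
    then have "X = conn D r' `` (conn D r `` {x})"
      using assms(2) conn_refl[OF x(1), of r] by (auto intro: conn_trans conn_sym)
    then show "X \<in> (\<lambda>C. conn D r' `` C) ` conn_classes D r"
      using conn_class_in[OF x(1)] by (rule image_eqI)
  qed
qed

lemma card_conn_classes_disjoint_Un:
  assumes "finite D" "finite D'" "D \<inter> D' = {}"
    and "\<And>x y. (x, y) \<in> r \<Longrightarrow> x \<in> D \<and> y \<in> D"
    and "\<And>x y. (x, y) \<in> r' \<Longrightarrow> x \<in> D' \<and> y \<in> D'"
  shows "card (conn_classes (D \<union> D') (r \<union> r')) =
    card (conn_classes D r) + card (conn_classes D' r')"
proof -
  have "equiv (D \<union> D') (conn D r \<union> conn D' r')"
    unfolding equiv_def
  proof (intro conjI)
    show "trans (conn D r \<union> conn D' r')"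
      using assms(3) conn_subset[of D r] conn_subset[of D' r'] unfolding trans_def
      by (blast intro: conn_trans)
  qed (use conn_subset[of D r] conn_subset[of D' r'] in
      \<open>auto simp: refl_on_def sym_def intro: conn_refl conn_sym\<close>)
  then have "conn (D \<union> D') (r \<union> r') \<subseteq> conn D r \<union> conn D' r'"
    by (rule conn_least) (use assms(4,5) in \<open>blast intro: conn_edge\<close>)
  moreover have "conn D r \<subseteq> conn (D \<union> D') (r \<union> r')"
    using conn_map[of _ _ D r id "D \<union> D'" "r \<union> r'"] by (auto intro: conn_edge)
  moreover have "conn D' r' \<subseteq> conn (D \<union> D') (r \<union> r')"
    using conn_map[of _ _ D' r' id "D \<union> D'" "r \<union> r'"] by (auto intro: conn_edge)
  ultimately have eq: "conn (D \<union> D') (r \<union> r') = conn D r \<union> conn D' r'" by blast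
  have 1: "conn (D \<union> D') (r \<union> r') `` {x} = conn D r `` {x}" if "x \<in> D" for x
    using that assms(3) conn_subset[of D' r'] unfolding eq by blast
  have 2: "conn (D \<union> D') (r \<union> r') `` {x} = conn D' r' `` {x}" if "x \<in> D'" for x
    using that assms(3) conn_subset[of D r] unfolding eq by blast
  have "conn_classes (D \<union> D') (r \<union> r') = conn_classes D r \<union> conn_classes D' r'"
    unfolding conn_classes_conn quotient_def using 1 2 by auto
  moreover have "conn_classes D r \<inter> conn_classes D' r' = {}"
  proof (rule ccontr)
    assume "conn_classes D r \<inter> conn_classes D' r' \<noteq> {}"
    then obtain C where C: "C \<in> conn_classes D r" "C \<in> conn_classes D' r'" by blast
    then have "C \<subseteq> D" "C \<subseteq> D'"
      using Union_conn_classes[of D r] Union_conn_classes[of D' r'] by blast+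
    then show False using assms(3) conn_classes_nonempty[OF C(1)] by blast
  qed
  ultimately show ?thesis
    using card_Un_disjoint finite_conn_classes assms(1,2) by metis
qed

lemma even_card_involution:
  assumes "finite S" and "\<And>x. x \<in> S \<Longrightarrow> g x \<in> S \<and> g (g x) = x \<and> g x \<noteq> x"
  shows "even (card S)"
  using assms
proof (induction "card S" arbitrary: S rule: less_induct)
  case less
  show ?case
  proof (cases "S = {}")
    case False
    then obtain x where x: "x \<in> S" by blast
    let ?T = "S - {x, g x}"
    have "x \<noteq> g x" using less.prems(2)[OF x] by metis
    then have c: "card S = card ?T + 2"
      using x less.prems(1) less.prems(2)[OF x] card_Diff_subset[of "{x, g x}" S]
        card_mono[of S "{x, g x}"] by simp
    have "g y \<in> ?T \<and> g (g y) = y \<and> g y \<noteq> y" if "y \<in> ?T" for y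
      using that less.prems(2)[of y] less.prems(2)[OF x] by auto
    then have "even (card ?T)" using less.hyps[of ?T] c less.prems(1) by auto
    then show ?thesis using c by simp
  qed simp
qed

section \<open>Euler genus of spanning ribbon subgraphs\<close>

text \<open>Invariant principle: a property that no arc changes is constant on each class.\<close>

lemma conn_class_subset:
  assumes "C \<in> conn_classes D r" "a \<in> C" "a \<in> S"
    and "\<And>x y. (x, y) \<in> r \<Longrightarrow> x \<in> D \<Longrightarrow> y \<in> D \<Longrightarrow> x \<in> S \<longleftrightarrow> y \<in> S"
  shows "C \<subseteq> S"
proof -
  have "equiv D {(x, y). x \<in> D \<and> y \<in> D \<and> (x \<in> S \<longleftrightarrow> y \<in> S)}"
    by (auto simp: equiv_def refl_on_def sym_def trans_def)
  then have "conn D r \<subseteq> {(x, y). x \<in> D \<and> y \<in> D \<and> (x \<in> S \<longleftrightarrow> y \<in> S)}"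
    by (rule conn_least) (use assms(4) in blast)
  moreover have "C = conn D r `` {a}" by (rule conn_classes_eq_class[OF assms(1,2)])
  ultimately show ?thesis using assms(3) by blast
qed

abbreviation arcs :: "'a set \<Rightarrow> ('a \<Rightarrow> 'a) set \<Rightarrow> ('a \<times> 'a) set" where
  "arcs D G \<equiv> {(x, g x) | x g. x \<in> D \<and> g \<in> G}"

lemma mem_arcs2: "(x, y) \<in> arcs D {f, g} \<longleftrightarrow> x \<in> D \<and> (y = f x \<or> y = g x)"
  by blast

lemma mem_arcs3: "(x, y) \<in> arcs D {f, g, h} \<longleftrightarrow> x \<in> D \<and> (y = f x \<or> y = g x \<or> y = h x)"
  by blast

lemma orbits_subset: "C \<in> orbits D G \<Longrightarrow> C \<subseteq> D"
  using Union_conn_classes[of D "arcs D G"] unfolding orbits_def by auto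

lemma orbits_closed:
  "C \<in> orbits D G \<Longrightarrow> x \<in> C \<Longrightarrow> g \<in> G \<Longrightarrow> g x \<in> D \<Longrightarrow> g x \<in> C"
  using orbits_subset[of C D G] unfolding orbits_def
  by (blast intro: conn_classes_closed conn_edge)

locale embedded =
  fixes H :: "'f flag_graph"
  assumes embedded: "embedded_graph H"
begin

abbreviation "D \<equiv> flags H"
abbreviation "fV \<equiv> flipV H"
abbreviation "fE \<equiv> flipE H"
abbreviation "fF \<equiv> flipF H"

lemma finite_flags [simp]: "finite D"
  using embedded by (simp add: embedded_graph_def)

lemma flip_in [simp]:
  "x \<in> D \<Longrightarrow> fV x \<in> D" "x \<in> D \<Longrightarrow> fE x \<in> D" "x \<in> D \<Longrightarrow> fF x \<in> D"
  using embedded by (simp_all add: embedded_graph_def)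

lemma flip_flip [simp]:
  "x \<in> D \<Longrightarrow> fV (fV x) = x" "x \<in> D \<Longrightarrow> fE (fE x) = x" "x \<in> D \<Longrightarrow> fF (fF x) = x"
  using embedded by (simp_all add: embedded_graph_def)

lemma flip_neq [simp]:
  "x \<in> D \<Longrightarrow> fV x \<noteq> x" "x \<in> D \<Longrightarrow> fE x \<noteq> x" "x \<in> D \<Longrightarrow> fF x \<noteq> x"
  using embedded by (simp_all add: embedded_graph_def)

lemma flipV_flipF: "x \<in> D \<Longrightarrow> fV (fF x) = fF (fV x)"
  using embedded by (simp add: embedded_graph_def)

lemma flipV_neq_flipF: "x \<in> D \<Longrightarrow> fV x \<noteq> fF x"
  using embedded by (simp add: embedded_graph_def)

text \<open>\<open>fV\<close> and \<open>fF\<close> are commuting involutions, and neither they nor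
  their product fix a flag. They act as a Klein four-group, freely, so an edge has exactly four
  flags.\<close>

lemma edge_flags:
  assumes "e \<in> edges H" "a \<in> e"
  shows "e = {a, fF a, fV a, fF (fV a)}" "distinct [a, fF a, fV a, fF (fV a)]"
proof -
  have a: "a \<in> D" using assms orbits_subset unfolding edges_def by blast
  let ?S = "{a, fF a, fV a, fF (fV a)}"
  have "e \<subseteq> ?S"
  proof (rule conn_class_subset)
    show "e \<in> conn_classes D (arcs D {fV, fF})" using assms by (simp add: edges_def orbits_def)
    have cl: "g x \<in> ?S" if "x \<in> ?S" "g \<in> {fV, fF}" for x g
      using that a by (auto simp: flipV_flipF)
    show "x \<in> ?S \<longleftrightarrow> y \<in> ?S" if xy: "(x, y) \<in> arcs D {fV, fF}" for x y
    proof -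
      obtain g where g: "g \<in> {fV, fF}" "y = g x" "x \<in> D" using xy by blast
      then have "g y = x" by auto
      then show ?thesis using cl[of x g] cl[of y g] g by metis
    qed
  qed (use assms in auto)
  moreover have "?S \<subseteq> e"
    using assms a orbits_closed[of e D "{fV, fF}"] unfolding edges_def by auto
  ultimately show "e = ?S" by (rule equalityI)
  have "a \<noteq> fF a" "a \<noteq> fV a" "fV a \<noteq> fF a" "fV a \<noteq> fF (fV a)" "fF a \<noteq> fF (fV a)" "a \<noteq> fF (fV a)"
    using a flip_neq[OF a] flip_neq(3)[of "fV a"] flipV_neq_flipF[OF a] flip_flip(3) flip_in
    by metis+
  then show "distinct [a, fF a, fV a, fF (fV a)]" by auto
qed

lemma edge_in_flags: "e \<in> edges H \<Longrightarrow> e \<subseteq> D"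
  unfolding edges_def by (rule orbits_subset)

lemma edge_closed: "e \<in> edges H \<Longrightarrow> x \<in> e \<Longrightarrow> fV x \<in> e \<and> fF x \<in> e"
  using edge_flags(1)[of e x] edge_in_flags[of e] flipV_flipF[of x] by auto

lemma edges_disjoint: "e \<in> edges H \<Longrightarrow> e' \<in> edges H \<Longrightarrow> x \<in> e \<Longrightarrow> x \<in> e' \<Longrightarrow> e = e'"
  unfolding edges_def orbits_def by (rule conn_classes_disjoint)

lemma finite_edges: "finite (edges H)"
  unfolding edges_def orbits_def by (simp add: finite_conn_classes)

definition side :: "'f set set \<Rightarrow> 'f \<Rightarrow> 'f" where
  "side A x = (if x \<in> \<Union>A then fV x else fF x)"

lemma side_mem_Union_iff:
  assumes "A \<subseteq> edges H" "x \<in> D"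
  shows "fV x \<in> \<Union>A \<longleftrightarrow> x \<in> \<Union>A" "fF x \<in> \<Union>A \<longleftrightarrow> x \<in> \<Union>A"
proof -
  have "fV y \<in> \<Union>A \<and> fF y \<in> \<Union>A" if "y \<in> \<Union>A" for y
    using that assms(1) edge_closed by blast
  from this[of x] this[of "fV x"] this[of "fF x"]
  show "fV x \<in> \<Union>A \<longleftrightarrow> x \<in> \<Union>A" "fF x \<in> \<Union>A \<longleftrightarrow> x \<in> \<Union>A"
    unfolding flip_flip(1,3)[OF assms(2)] by blast+
qed

text \<open>Together with \<open>fE\<close>, this makes the boundary curves orbits of two
  involutions without fixed points, that is, cycles in which the two kinds of arcs
  alternate.\<close>

lemma side_involution:
  assumes "A \<subseteq> edges H" "x \<in> D"
  shows "side A x \<in> D" "side A (side A x) = x" "side A x \<noteq> x"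
  using assms side_mem_Union_iff[OF assms] unfolding side_def by auto

text \<open>For \<open>e \<notin> A\<close> this is what the boundaries of \<open>A\<close> and
  \<open>insert e A\<close> have in common; they differ only in how the four flags of
  \<open>e\<close> are joined.\<close>

definition cut_rel :: "'f set set \<Rightarrow> 'f set \<Rightarrow> ('f \<times> 'f) set" where
  "cut_rel A e = {(x, fE x) | x. x \<in> D} \<union> {(x, side A x) | x. x \<in> D - e}"

lemma boundary_comps_side: "boundary_comps H A = conn_classes D (arcs D {fE, side A})"
  unfolding boundary_comps_def orbits_def side_def by simp

end

section \<open>Effect of one additional ribbon on components and boundary\<close>

locale new_edge = embedded H for H :: "'f flag_graph" +
  fixes A e a b c d
  assumes A: "A \<subseteq> edges H" and e: "e \<in> edges H" "e \<notin> A" and a: "a \<in> e"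
    and bcd: "b = fF a" "c = fV a" "d = fF (fV a)"
begin

text \<open>The pairs \<open>a\<close>, \<open>b\<close> and \<open>c\<close>, \<open>d\<close> are
  the two ends of the ribbon \<open>e\<close>; the pairs \<open>a\<close>, \<open>c\<close> and
  \<open>b\<close>, \<open>d\<close> are its two sides.\<close>

lemma e_eq: "e = {a, b, c, d}" and distinct: "distinct [a, b, c, d]"
  using edge_flags[OF e(1) a] bcd by auto

lemma in_D: "a \<in> D" "b \<in> D" "c \<in> D" "d \<in> D"
  using edge_in_flags[OF e(1)] e_eq by auto

lemma flips: "fF a = b" "fF b = a" "fF c = d" "fF d = c" "fV a = c" "fV c = a" "fV b = d" "fV d = b"
  using in_D bcd by (auto simp: flipV_flipF)

lemma e_not_in: "x \<in> e \<Longrightarrow> x \<notin> \<Union>A"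
  using A e edges_disjoint by blast

lemma side_old: "x \<in> e \<Longrightarrow> side A x = fF x"
  using e_not_in unfolding side_def by auto

lemma side_new: "side (insert e A) x = (if x \<in> e then fV x else side A x)"
  unfolding side_def by auto

abbreviation "G \<equiv> cut_rel A e"

lemma cut_edge: "x \<in> D \<Longrightarrow> (x, fE x) \<in> conn D G" "x \<in> D \<Longrightarrow> x \<notin> e \<Longrightarrow> (x, side A x) \<in> conn D G"
  using side_involution(1)[OF A] unfolding cut_rel_def by (auto intro: conn_edge)

text \<open>Where the ribbon is absent, the boundary follows the vertex discs across its two ends;
  once it is present, as in \<open>conn_boundary_new\<close>, the boundary follows its two
  sides.\<close>

lemma conn_boundary_old:
  "conn D (arcs D {fE, side A}) = conn D (insert (a, b) (insert (c, d) G))" (is "_ = conn D ?r")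
proof (rule conn_cong)
  fix x y assume xy: "(x, y) \<in> arcs D {fE, side A}" "x \<in> D" "y \<in> D"
  have ab: "(a, b) \<in> conn D ?r" "(c, d) \<in> conn D ?r"
    using in_D by (auto intro: conn_edge)
  show "(x, y) \<in> conn D ?r"
  proof (cases "y = side A x \<and> x \<in> e")
    case True
    then show ?thesis
      using side_old[of x] e_eq flips ab conn_sym[OF ab(1)] conn_sym[OF ab(2)] by auto
  next
    case False
    then have "(x, y) \<in> G" using xy unfolding cut_rel_def by auto
    then show ?thesis using xy by (auto intro: conn_edge)
  qed
next
  fix x y assume xy: "(x, y) \<in> ?r" "x \<in> D" "y \<in> D"
  have "side A a = b" "side A c = d" using side_old e_eq flips by simp_all
  moreover from xy have "x = a \<and> y = b \<or> x = c \<and> y = d \<or> y = fE x \<or> y = side A x"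
    unfolding cut_rel_def by blast
  ultimately have "(x, y) \<in> arcs D {fE, side A}"
    unfolding mem_arcs2 using xy(2) by metis
  then show "(x, y) \<in> conn D (arcs D {fE, side A})" using xy by (auto intro: conn_edge)
qed

lemma conn_boundary_new:
  "conn D (arcs D {fE, side (insert e A)}) = conn D (insert (a, c) (insert (b, d) G))"
  (is "_ = conn D ?r")
proof (rule conn_cong)
  fix x y assume xy: "(x, y) \<in> arcs D {fE, side (insert e A)}" "x \<in> D" "y \<in> D"
  have ac: "(a, c) \<in> conn D ?r" "(b, d) \<in> conn D ?r"
    using in_D by (auto intro: conn_edge)
  show "(x, y) \<in> conn D ?r"
  proof (cases "y = side (insert e A) x \<and> x \<in> e")
    case True
    then show ?thesis
      using side_new[of x] e_eq flips ac conn_sym[OF ac(1)] conn_sym[OF ac(2)] by auto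
  next
    case False
    then have "(x, y) \<in> G" using xy side_new unfolding cut_rel_def by auto
    then show ?thesis using xy by (auto intro: conn_edge)
  qed
next
  fix x y assume xy: "(x, y) \<in> ?r" "x \<in> D" "y \<in> D"
  have "side (insert e A) a = c" "side (insert e A) b = d" using side_new e_eq flips by simp_all
  moreover from xy have "x = a \<and> y = c \<or> x = b \<and> y = d \<or> y = fE x \<or> x \<notin> e \<and> y = side A x"
    unfolding cut_rel_def by blast
  ultimately have "(x, y) \<in> arcs D {fE, side (insert e A)}"
    unfolding mem_arcs2 using xy(2) side_new by metis
  then show "(x, y) \<in> conn D (arcs D {fE, side (insert e A)})" using xy by (auto intro: conn_edge)
qed

abbreviation ribbon_arcs :: "'f set set \<Rightarrow> ('f \<times> 'f) set" where
  "ribbon_arcs B \<equiv> arcs D {fE, fF, \<lambda>x. if x \<in> \<Union>B then fV x else x}"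

lemma mem_ribbon_arcs:
  "(x, y) \<in> ribbon_arcs B \<longleftrightarrow> x \<in> D \<and> (y = fE x \<or> y = fF x \<or> y = (if x \<in> \<Union>B then fV x else x))"
  unfolding mem_arcs3 by (rule refl)

text \<open>One side of the ribbon suffices for connectivity, because \<open>fF\<close> already
  connects the two flags at each of its ends.\<close>

lemma conn_ribbon_new:
  "conn D (ribbon_arcs (insert e A)) = conn D (insert (a, c) (ribbon_arcs A))" (is "_ = conn D ?r")
proof (rule conn_cong)
  have arc: "(x, y) \<in> conn D ?r" if "(x, y) \<in> ribbon_arcs A" "y \<in> D" for x y
    using that by (intro conn_edge) blast+
  have ac: "(a, c) \<in> conn D ?r" using in_D by (auto intro: conn_edge)
  moreover have "(b, a) \<in> conn D ?r" "(c, d) \<in> conn D ?r"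
    using arc[of b a] arc[of c d] in_D flips unfolding mem_ribbon_arcs by simp_all
  ultimately have bd: "(b, d) \<in> conn D ?r" by (meson conn_trans)
  fix x y assume xy: "(x, y) \<in> ribbon_arcs (insert e A)" "x \<in> D" "y \<in> D"
  show "(x, y) \<in> conn D ?r"
  proof (cases "x \<in> e \<and> y = fV x")
    case True
    then show ?thesis using e_eq flips ac bd conn_sym[OF ac] conn_sym[OF bd] by auto
  next
    case False
    then have "y = x \<or> (x, y) \<in> ribbon_arcs A"
      using xy unfolding mem_ribbon_arcs by (auto split: if_splits)
    then show ?thesis
    proof
      assume "y = x" then show ?thesis using xy(2) conn_refl by simp
    next
      assume "(x, y) \<in> ribbon_arcs A" then show ?thesis using xy(3) by (rule arc)
    qed
  qed
next
  fix x y assume xy: "(x, y) \<in> ?r" "x \<in> D" "y \<in> D"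
  from xy(1) have "x = a \<and> y = c \<or> (x, y) \<in> ribbon_arcs A" by blast
  then have "y = x \<or> (x, y) \<in> ribbon_arcs (insert e A)"
    using xy(2) a flips(5) unfolding mem_ribbon_arcs by (auto split: if_splits)
  then show "(x, y) \<in> conn D (ribbon_arcs (insert e A))"
  proof
    assume "y = x" then show ?thesis using xy(2) conn_refl by simp
  next
    assume "(x, y) \<in> ribbon_arcs (insert e A)" then show ?thesis using xy(2,3) by (rule conn_edge)
  qed
qed

lemma subgraph_comps_ribbon: "subgraph_comps H B = conn_classes D (ribbon_arcs B)"
  by (simp add: subgraph_comps_def orbits_def)

lemma cut_class_subset: "S \<in> conn_classes D G \<Longrightarrow> S \<subseteq> D"
  using Union_conn_classes[of D G] by blast

lemma cut_class_closed:
  assumes "S \<in> conn_classes D G" "x \<in> S"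
  shows "fE x \<in> S" and "x \<notin> e \<Longrightarrow> side A x \<in> S"
  using assms cut_class_subset[OF assms(1)] cut_edge conn_classes_closed[OF assms] by blast+

lemma side_not_in: 
  assumes "x \<in> D" "x \<notin> e" shows "side A x \<notin> e"
proof
  assume "side A x \<in> e"
  then have "side A (side A x) \<in> e" using edge_closed[OF e(1)] unfolding side_def by auto
  then show False using side_involution(2)[OF A assms(1)] assms(2) by simp
qed

text \<open>
  Without the arcs at \<open>e\<close>, the boundary curves fall into cycles and paths, and the flags in \<open>e\<close> are
  the ends of the paths.
\<close>

lemma even_ends:
  assumes "S \<in> conn_classes D G"
  shows "even (card (S \<inter> e))"
proof -
  note SD = cut_class_subset[OF assms]
  have fin: "finite S" using SD finite_flags by (rule finite_subset)
  have "even (card S)"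
    by (rule even_card_involution[where g = fE])
      (use fin SD cut_class_closed[OF assms] in \<open>auto simp: subset_iff\<close>)
  moreover have "even (card (S - e))"
    by (rule even_card_involution[where g = "side A"])
      (use fin SD cut_class_closed[OF assms] side_involution[OF A] side_not_in in
        \<open>auto simp: subset_iff\<close>)
  moreover have "card S = card (S \<inter> e) + card (S - e)"
    using fin card_Int_Diff by blast
  ultimately show ?thesis by simp
qed

text \<open>Adding the arc from \<open>a\<close> to \<open>b\<close> to the new boundary connects
  all four flags of \<open>e\<close>, which makes it at least as coarse as the old boundary; a
  single arc costs at most one class.\<close>

lemma card_boundary_le: "card (boundary_comps H (insert e A)) \<le> Suc (card (boundary_comps H A))"
proof -
  let ?new = "insert (a, c) (insert (b, d) G)"
  have "(c, d) \<in> conn D (insert (a, b) ?new)"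
  proof -
    have "(c, a) \<in> conn D (insert (a, b) ?new)" "(a, b) \<in> conn D (insert (a, b) ?new)"
      "(b, d) \<in> conn D (insert (a, b) ?new)"
      using in_D by (auto intro: conn_edge conn_sym)
    then show ?thesis by (blast intro: conn_trans)
  qed
  moreover have "(a, b) \<in> conn D (insert (a, b) ?new)" using in_D by (auto intro: conn_edge)
  ultimately have "conn D (insert (a, b) (insert (c, d) G)) \<subseteq> conn D (insert (a, b) ?new)"
    by (intro conn_mono) (auto intro: conn_edge)
  then have "card (conn_classes D (insert (a, b) ?new)) \<le> card (boundary_comps H A)"
    unfolding boundary_comps_side conn_classes_conn[of D "arcs D {fE, side A}"] conn_boundary_old
    unfolding conn_classes_conn[symmetric]
    by (intro card_conn_classes_antimono) simp_all
  moreover have "card (boundary_comps H (insert e A)) = card (conn_classes D ?new)"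
    unfolding boundary_comps_side conn_classes_conn conn_boundary_new ..
  ultimately show ?thesis
    using card_conn_classes_le_Suc_insert[of D ?new a b] by simp
qed

lemma conn_cut_subset: "conn D G \<subseteq> conn D (ribbon_arcs A)"
proof (rule conn_mono)
  fix x y assume xy: "(x, y) \<in> G" "x \<in> D" "y \<in> D"
  then have "(x, y) \<in> ribbon_arcs A"
    unfolding mem_ribbon_arcs cut_rel_def side_def by (auto split: if_splits)
  then show "(x, y) \<in> conn D (ribbon_arcs A)"
    using xy(2,3) by (rule conn_edge)
qed

text \<open>The ribbon joins two different components here. A path starting at \<open>a\<close>
  cannot reach the other end of the ribbon, so by parity it ends at \<open>b\<close>, and likewise
  \<open>c\<close> is joined to \<open>d\<close>. The ribbon then fuses two boundary curves into
  one.\<close>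

lemma card_boundary_merge:
  assumes "(a, c) \<notin> conn D (ribbon_arcs A)"
  shows "card (boundary_comps H A) = Suc (card (boundary_comps H (insert e A)))"
proof -
  let ?K = "conn D (ribbon_arcs A)"
  have K: "(a, b) \<in> ?K" "(c, d) \<in> ?K"
    by (rule conn_edge; (unfold mem_ribbon_arcs)?; simp add: in_D flips)+
  have nac: "(a, c) \<notin> conn D G" "(a, d) \<notin> conn D G" "(c, a) \<notin> conn D G" "(c, b) \<notin> conn D G"
    using assms conn_cut_subset K by (meson conn_sym conn_trans subsetD)+
  have two: "(p, q) \<in> conn D G"
    \<comment> \<open>The class of \<open>p\<close> holds an even number of flags of
      \<open>e\<close>, and \<open>q\<close> is the only other candidate.\<close>
    if "p \<in> D" "S = conn D G `` {p}" "S \<inter> e \<subseteq> {p, q}" "p \<in> e" "p \<noteq> q" for p q S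
  proof (rule ccontr)
    assume "(p, q) \<notin> conn D G"
    then have "S \<inter> e = {p}" using that conn_refl[OF that(1), of G] by auto
    then have "odd (card (S \<inter> e))" by simp
    then show False using even_ends[of S] conn_class_in[OF that(1)] that(2) by simp
  qed
  have ab: "(a, b) \<in> conn D G"
    by (rule two) (use in_D nac e_eq distinct in auto)
  have cd: "(c, d) \<in> conn D G"
    by (rule two) (use in_D nac e_eq distinct in auto)
  show ?thesis
    unfolding boundary_comps_side conn_classes_conn conn_boundary_old conn_boundary_new
    unfolding conn_classes_conn[symmetric]
    by (rule card_conn_classes_repair) (use in_D nac ab cd in simp_all)
qed

lemma finite_A: "finite A"
  using A finite_edges by (rule finite_subset)

text \<open>Inside one component, the number of components stays, the boundary count grows by at
  most 1 and the edge count by 1, so the genus does not drop. Between two components, the doubled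
  component count drops by 2, which the lost boundary curve and the new edge compensate
  exactly.\<close>

lemma euler_genus_le_insert: "euler_genus H A \<le> euler_genus H (insert e A)"
proof -
  have cA: "card (insert e A) = Suc (card A)" using finite_A e by simp
  have k: "card (subgraph_comps H (insert e A)) = card (conn_classes D (insert (a, c) (ribbon_arcs A)))"
    unfolding subgraph_comps_ribbon conn_classes_conn conn_ribbon_new ..
  show ?thesis
  proof (cases "(a, c) \<in> conn D (ribbon_arcs A)")
    case True
    have "card (subgraph_comps H (insert e A)) = card (subgraph_comps H A)"
      unfolding k unfolding subgraph_comps_ribbon conn_classes_conn conn_insert_redundant[OF True] ..
    then show ?thesis using card_boundary_le cA unfolding euler_genus_def by simp
  next
    case False
    then have "card (subgraph_comps H A) = Suc (card (subgraph_comps H (insert e A)))"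
      unfolding k unfolding subgraph_comps_ribbon using in_D by (intro card_conn_classes_insert) auto
    then show ?thesis using card_boundary_merge[OF False] cA unfolding euler_genus_def by simp
  qed
qed

end

section \<open>Parity of the boundary count for orientable ribbon graphs\<close>

lemma card_balanced:
  assumes "finite S" "\<And>x. x \<in> S \<Longrightarrow> g x \<in> S \<and> g (g x) = x \<and> (g x \<in> P \<longleftrightarrow> x \<notin> P)"
  shows "card (S \<inter> P) = card (S - P)"
  by (rule bij_betw_same_card[OF bij_betw_byWitness[where f = g and f' = g]])
    (use assms in auto)

context new_edge
begin

text \<open>
  A component on \<open>n\<close> flags has at least \<open>n - 1\<close> arcs. Each arc has exactly one positive end, so the
  arcs can be counted by these ends.
\<close>

lemma card_positive_ends:
  assumes S: "S \<in> conn_classes D G"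
    and pos: "\<And>x. x \<in> D \<Longrightarrow> fV x \<in> pos \<longleftrightarrow> x \<notin> pos" "\<And>x. x \<in> D \<Longrightarrow> fE x \<in> pos \<longleftrightarrow> x \<notin> pos"
      "\<And>x. x \<in> D \<Longrightarrow> fF x \<in> pos \<longleftrightarrow> x \<notin> pos"
  shows "card (S \<inter> e \<inter> pos) \<le> 1" "card (S \<inter> e - pos) \<le> 1"
proof -
  note SD = cut_class_subset[OF S]
  note closed = cut_class_closed[OF S]
  have fin: "finite S" using SD finite_flags by (rule finite_subset)
  have side_pos: "side A x \<in> pos \<longleftrightarrow> x \<notin> pos" if "x \<in> D" for x
    using pos that unfolding side_def by simp
  have eqE: "card (S \<inter> pos) = card (S - pos)"
    by (rule card_balanced[where g = fE]) (use fin SD closed pos in \<open>auto simp: subset_iff\<close>)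
  have eqs: "card ((S - e) \<inter> pos) = card ((S - e) - pos)"
  proof (rule card_balanced[where g = "side A"])
    fix x assume "x \<in> S - e"
    then show "side A x \<in> S - e \<and> side A (side A x) = x \<and> (side A x \<in> pos \<longleftrightarrow> x \<notin> pos)"
      using SD closed side_involution[OF A] side_not_in side_pos by blast
  qed (use fin in simp)
  have split: "card X = card (X \<inter> P) + card (X - P)" if "X \<subseteq> S" for X P
    using card_Int_Diff finite_subset[OF that fin] by blast
  have s1: "card S = card (S \<inter> pos) + card (S - pos)" by (rule split) simp
  have s2: "card (S \<inter> pos) = card (S \<inter> e \<inter> pos) + card ((S - e) \<inter> pos)"
  proof -
    have "S \<inter> pos \<inter> e = S \<inter> e \<inter> pos" "S \<inter> pos - e = (S - e) \<inter> pos" by auto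
    then show ?thesis using split[of "S \<inter> pos" e] by simp
  qed
  have s3: "card (S - pos) = card (S \<inter> e - pos) + card ((S - e) - pos)"
  proof -
    have "(S - pos) \<inter> e = S \<inter> e - pos" "S - pos - e = (S - e) - pos" by auto
    then show ?thesis using split[of "S - pos" e] by simp
  qed
  \<comment> \<open>Each arc inside \<open>S\<close> is recorded at its positive end. Flags in
    \<open>e\<close> have only their \<open>fE\<close> arc, hence the smaller index set for
    \<open>side A\<close>.\<close>
  define r where "r = (\<lambda>x. (x, fE x)) ` (S \<inter> pos) \<union> (\<lambda>x. (x, side A x)) ` ((S - e) \<inter> pos)"
  have r1: "card r \<le> card (S \<inter> pos) + card ((S - e) \<inter> pos)"
    unfolding r_def using fin
    by (intro order_trans[OF card_Un_le] add_mono card_image_le) auto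
  have r2: "finite r" using fin unfolding r_def by simp
  have arc: "y \<in> S \<and> (x, y) \<in> conn S r" if xy: "x \<in> S" "(x, y) \<in> G" for x y
  proof -
    have x: "x \<in> D" using that SD by blast
    consider "y = fE x" | "x \<notin> e" "y = side A x" using xy unfolding cut_rel_def by blast
    then show ?thesis
    proof cases
      case 1
      then have y: "y \<in> S" "x = fE y" using closed that x by auto
      have "(x, y) \<in> r \<or> (y, x) \<in> r"
        using 1 y pos(2)[OF x] that(1) unfolding r_def by blast
      then show ?thesis using y that(1) conn_edge conn_sym by metis
    next
      case 2
      then have y: "y \<in> S" "x = side A y" "y \<notin> e"
        using closed that x side_involution[OF A x] side_not_in[OF x] by auto
      have "(x, y) \<in> r \<or> (y, x) \<in> r"
        using 2 y side_pos[OF x] that(1) unfolding r_def by blast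
      then show ?thesis using y that(1) conn_edge conn_sym by metis
    qed
  qed
  have G_sym: "(y, x) \<in> G" if "(x, y) \<in> G" for x y
    using that side_involution[OF A] side_not_in unfolding cut_rel_def by fastforce
  have conn_S: "S \<subseteq> {y \<in> S. (p, y) \<in> conn S r}" if "p \<in> S" for p
  proof (rule conn_class_subset[OF S that])
    show "p \<in> {y \<in> S. (p, y) \<in> conn S r}" using that by (simp add: conn_refl)
    show "x \<in> {y \<in> S. (p, y) \<in> conn S r} \<longleftrightarrow> y \<in> {y \<in> S. (p, y) \<in> conn S r}"
      if "(x, y) \<in> G" for x y
      using arc[of x y] arc[of y x] that G_sym[OF that] by (blast intro: conn_trans)
  qed
  have "C = S" if C: "C \<in> conn_classes S r" for C
  proof -
    obtain x where x: "x \<in> S" "C = conn S r `` {x}"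
      using C unfolding conn_classes_conn by (auto elim: quotientE)
    then show ?thesis using conn_S[OF x(1)] conn_subset[of S r] by blast
  qed
  then have "conn_classes S r \<subseteq> {S}" by blast
  then have "card (conn_classes S r) \<le> card {S}" by (intro card_mono) auto
  then have "card S \<le> 1 + card r" using card_le_conn_classes_plus_edges[OF fin r2] by simp
  \<comment> \<open>With \<open>n = card S\<close> and \<open>m\<close> positive flags of
    \<open>e\<close> in \<open>S\<close>, \<open>card r\<close> is at most
    \<open>n/2 + (n/2 - m) = n - m\<close>, while connecting \<open>S\<close> takes at least
    \<open>n - 1\<close> arcs. By \<open>eqE\<close> and \<open>eqs\<close> the negative flags of
    \<open>e\<close> in \<open>S\<close> are equally many.\<close>
  then show "card (S \<inter> e \<inter> pos) \<le> 1" "card (S \<inter> e - pos) \<le> 1"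
    using r1 s1 s2 s3 eqE eqs by linarith+
qed

text \<open>The four flags of \<open>e\<close> can be joined by paths in three ways. Joining
  \<open>a\<close> to \<open>d\<close> and \<open>b\<close> to \<open>c\<close> would leave one
  curve before and after, but a path has ends of opposite sign, while \<open>a\<close> and
  \<open>d\<close> have the same sign. In the other two cases a curve splits or two curves
  merge.\<close>

lemma orientable_boundary_parity:
  assumes "orientable H"
  shows "even (card (boundary_comps H (insert e A))) \<longleftrightarrow> odd (card (boundary_comps H A))"
proof -
  obtain pos where flip_pos: "\<forall>g \<in> {fV, fE, fF}. \<forall>x \<in> D. g x \<in> pos \<longleftrightarrow> x \<notin> pos"
    using assms unfolding orientable_def by blast
  then have pos: "\<And>x. x \<in> D \<Longrightarrow> fV x \<in> pos \<longleftrightarrow> x \<notin> pos"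
    "\<And>x. x \<in> D \<Longrightarrow> fE x \<in> pos \<longleftrightarrow> x \<notin> pos" "\<And>x. x \<in> D \<Longrightarrow> fF x \<in> pos \<longleftrightarrow> x \<notin> pos"
    by simp_all
  have diag: "(p, q) \<notin> conn D G" if "p \<in> e" "q \<in> e" "p \<noteq> q" "p \<in> pos \<longleftrightarrow> q \<in> pos" for p q
  proof
    let ?S = "conn D G `` {p}"
    assume pq: "(p, q) \<in> conn D G"
    have p: "p \<in> D" using that(1) edge_in_flags[OF e(1)] by blast
    have two: "2 \<le> card X" if "p \<in> X" "q \<in> X" "X \<subseteq> e" for X
      using card_mono[of X "{p, q}"] that \<open>p \<noteq> q\<close> finite_subset[of X e] e_eq by auto
    have "p \<in> ?S" "q \<in> ?S" using pq conn_refl[OF p] by auto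
    then show False
      using card_positive_ends[OF conn_class_in[OF p] pos] two[of "?S \<inter> e \<inter> pos"] two[of "?S \<inter> e - pos"] that
      by fastforce
  qed
  have signs: "b \<in> pos \<longleftrightarrow> a \<notin> pos" "c \<in> pos \<longleftrightarrow> a \<notin> pos" "d \<in> pos \<longleftrightarrow> a \<in> pos"
    using pos(1)[of a] pos(3)[of a] pos(3)[of c] in_D flips by auto
  have ad: "(a, d) \<notin> conn D G" and bc: "(b, c) \<notin> conn D G"
    by (rule diag; use e_eq distinct signs in simp)+
  have other: "\<exists>q \<in> e. q \<noteq> p \<and> (p, q) \<in> conn D G" if p: "p \<in> e" "p \<in> D" for p
  proof (rule ccontr)
    assume "\<not> ?thesis"
    then have "conn D G `` {p} \<inter> e = {p}" using p conn_refl[OF p(2), of G] by blast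
    then show False using even_ends[OF conn_class_in[OF p(2)]] by simp
  qed
  have "(a, b) \<in> conn D G \<or> (a, c) \<in> conn D G"
    using other[of a] e_eq in_D ad by auto
  moreover have "(d, b) \<in> conn D G \<or> (d, c) \<in> conn D G"
  proof -
    have "(d, a) \<notin> conn D G" using ad conn_sym by metis
    then show ?thesis using other[of d] e_eq in_D by auto
  qed
  ultimately consider "(a, b) \<in> conn D G" "(c, d) \<in> conn D G" "(a, c) \<notin> conn D G"
    | "(a, c) \<in> conn D G" "(b, d) \<in> conn D G" "(a, b) \<notin> conn D G"
    using ad bc by (meson conn_sym conn_trans)
  then show ?thesis
  proof cases
    case 1
    have "card (boundary_comps H A) = Suc (card (boundary_comps H (insert e A)))"
      unfolding boundary_comps_side conn_classes_conn conn_boundary_old conn_boundary_new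
      unfolding conn_classes_conn[symmetric]
      by (rule card_conn_classes_repair) (use in_D 1 in simp_all)
    then show ?thesis by simp
  next
    case 2
    have "card (boundary_comps H (insert e A)) = Suc (card (boundary_comps H A))"
      unfolding boundary_comps_side conn_classes_conn conn_boundary_old conn_boundary_new
      unfolding conn_classes_conn[symmetric]
      by (rule card_conn_classes_repair) (use in_D 2 in simp_all)
    then show ?thesis by simp
  qed
qed

end

section \<open>Nonnegativity and evenness of the Euler genus\<close>

context embedded
begin

text \<open>Without ribbons, components and boundary curves both correspond to the vertex
  discs.\<close>

lemma euler_genus_empty: "euler_genus H {} = 0"
proof -
  have "conn D (arcs D {fE, fF, \<lambda>x. x}) = conn D (arcs D {fE, fF})"
    by (rule conn_cong) (auto intro: conn_refl conn_edge)
  then show ?thesis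
    by (simp add: euler_genus_def subgraph_comps_def boundary_comps_def verts_def orbits_def
        conn_classes_conn)
qed

lemma new_edgeI:
  assumes "A \<subseteq> edges H" "e \<in> edges H" "e \<notin> A"
  obtains a where "new_edge H A e a (fF a) (fV a) (fF (fV a))"
proof -
  have "e \<noteq> {}" using assms(2) conn_classes_nonempty unfolding edges_def orbits_def by blast
  then obtain a where "a \<in> e" by blast
  then show ?thesis using assms embedded_axioms by (intro that[of a]) (unfold_locales, simp_all)
qed

theorem euler_genus_nonneg:
  assumes "A \<subseteq> edges H"
  shows "0 \<le> euler_genus H A"
proof -
  have "finite A" using assms finite_edges by (rule finite_subset)
  then show ?thesis using assms
  proof (induction A rule: finite_induct)
    case empty
    then show ?case by (simp add: euler_genus_empty)
  next
    case (insert e A)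
    then have A: "A \<subseteq> edges H" "e \<in> edges H" "e \<notin> A" by simp_all
    obtain a where "new_edge H A e a (fF a) (fV a) (fF (fV a))" by (rule new_edgeI[OF A])
    then have "euler_genus H A \<le> euler_genus H (insert e A)" by (rule new_edge.euler_genus_le_insert)
    then show ?case using insert.IH[OF A(1)] by simp
  qed
qed

text \<open>Modulo 2 the genus is the sum of the numbers of vertices, edges and boundary curves;
  each added edge changes the parity of the last two.\<close>

theorem even_euler_genus:
  assumes "A \<subseteq> edges H" "orientable H"
  shows "even (euler_genus H A)"
proof -
  have "finite A" using assms(1) finite_edges by (rule finite_subset)
  then show ?thesis using assms(1)
  proof (induction A rule: finite_induct)
    case empty
    then show ?case by (simp add: euler_genus_empty)
  next
    case (insert e A)
    then have A: "A \<subseteq> edges H" "e \<in> edges H" "e \<notin> A" by simp_all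
    obtain a where "new_edge H A e a (fF a) (fV a) (fF (fV a))" by (rule new_edgeI[OF A])
    then have "even (card (boundary_comps H (insert e A))) \<longleftrightarrow> odd (card (boundary_comps H A))"
      using assms(2) by (rule new_edge.orientable_boundary_parity)
    then show ?case using insert.IH[OF A(1)] insert.hyps unfolding euler_genus_def by simp
  qed
qed

end

section \<open>Tait graphs\<close>

lemma orbits_eqI:
  "C \<in> orbits D G \<Longrightarrow> C' \<in> orbits D G \<Longrightarrow> x \<in> C \<Longrightarrow> x \<in> C' \<Longrightarrow> C = C'"
  unfolding orbits_def by (rule conn_classes_disjoint)

lemma orbit_ex: "x \<in> D \<Longrightarrow> \<exists>C \<in> orbits D G. x \<in> C"
  using Union_conn_classes[of D "arcs D G"] unfolding orbits_def by blast

lemma finite_orbits: "finite D \<Longrightarrow> finite (orbits D G)"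
  unfolding orbits_def by (rule finite_conn_classes)

lemma card_eq_mult_card_orbits:
  assumes "finite D" "\<And>C. C \<in> orbits D G \<Longrightarrow> card C = k"
  shows "card D = k * card (orbits D G)"
proof -
  have U: "\<Union>(orbits D G) = D" unfolding orbits_def by (rule Union_conn_classes)
  show ?thesis
    using card_partition[of "orbits D G" k] assms finite_orbits[OF assms(1), of G] orbits_eqI[of _ D G]
    unfolding U by fastforce
qed

lemma arcs2_cong: "(\<And>x. x \<in> D \<Longrightarrow> g x = g' x) \<Longrightarrow> arcs D {f, g} = arcs D {f, g'}"
  by (intro set_eqI) (clarsimp simp only: split_paired_all mem_arcs2, metis)

lemma arcs3_cong: "(\<And>x. x \<in> D \<Longrightarrow> h x = h' x) \<Longrightarrow> arcs D {f, g, h} = arcs D {f, g, h'}"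
  by (intro set_eqI) (clarsimp simp only: split_paired_all mem_arcs3, metis)

context embedded
begin

abbreviation fG :: "'f \<Rightarrow> 'f" where "fG x \<equiv> fF (fE (fF x))"

text \<open>\<open>turn\<close> and \<open>ribbons\<close> are the boundary move and the ribbon move
  of the spanning subgraph of a face graph whose edges pass through the vertices in
  \<open>X\<close>. They are defined on all flags of the big graph, so that the same functions serve
  both colours and can be compared across \<open>fF\<close>.\<close>

definition turn :: "'f set set \<Rightarrow> 'f \<Rightarrow> 'f" where
  "turn X x = (if x \<in> \<Union>X then fG x else fE x)"

definition ribbons :: "'f set set \<Rightarrow> 'f \<Rightarrow> 'f" where
  "ribbons X x = (if x \<in> \<Union>X then fG x else x)"

end

section \<open>The face graph of one colour class\<close>

locale coloured = embedded F for F :: "'f flag_graph" +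
  fixes C :: "'f set set"
  assumes four_regular: "four_regular F" and checkerboard: "checkerboard F C"
begin

abbreviation "T \<equiv> face_graph F C"

lemma flags_T: "flags T = D \<inter> \<Union>C"
  and flips_T: "flipV T x = fG x" "flipE T = fV" "flipF T = fE"
  unfolding face_graph_def by simp_all

lemma C_subset: "C \<subseteq> faces F"
  using checkerboard unfolding checkerboard_def by blast

lemma colour_iff: "x \<in> f \<Longrightarrow> f \<in> faces F \<Longrightarrow> x \<in> \<Union>C \<longleftrightarrow> f \<in> C"
  using C_subset orbits_eqI[of f D "{fV, fE}" _ x] unfolding faces_def by blast

lemma ex_face: "x \<in> D \<Longrightarrow> \<exists>f \<in> faces F. x \<in> f"
  unfolding faces_def by (rule orbit_ex)

lemma flip_colour:
  assumes "x \<in> D"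
  shows "fV x \<in> \<Union>C \<longleftrightarrow> x \<in> \<Union>C" "fE x \<in> \<Union>C \<longleftrightarrow> x \<in> \<Union>C" "fF x \<in> \<Union>C \<longleftrightarrow> x \<notin> \<Union>C"
proof -
  obtain f where f: "f \<in> faces F" "x \<in> f" using ex_face[OF assms] by blast
  have "fV x \<in> f" "fE x \<in> f"
    using f assms orbits_closed[of f D "{fV, fE}"] unfolding faces_def by auto
  then show "fV x \<in> \<Union>C \<longleftrightarrow> x \<in> \<Union>C" "fE x \<in> \<Union>C \<longleftrightarrow> x \<in> \<Union>C"
    using f colour_iff by metis+
  obtain g where g: "g \<in> faces F" "fF x \<in> g" using ex_face[of "fF x"] assms by auto
  have "f \<in> C \<longleftrightarrow> g \<notin> C" using checkerboard f g unfolding checkerboard_def by blast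
  then show "fF x \<in> \<Union>C \<longleftrightarrow> x \<notin> \<Union>C" using f g colour_iff by metis
qed

lemma complement_colour: "x \<in> D \<Longrightarrow> x \<in> \<Union>(faces F - C) \<longleftrightarrow> x \<notin> \<Union>C"
  using ex_face[of x] colour_iff by blast

text \<open>Everything shown for the class \<open>C\<close> thereby holds for the other colour as
  well.\<close>

lemma coloured_complement: "coloured F (faces F - C)"
proof
  show "four_regular F" by (rule four_regular)
  show "checkerboard F (faces F - C)"
    using checkerboard unfolding checkerboard_def by blast
qed

lemma vert_closed: "v \<in> verts F \<Longrightarrow> x \<in> v \<Longrightarrow> fE x \<in> v \<and> fF x \<in> v"
  using orbits_closed[of v D "{fE, fF}" x] orbits_subset[of v D "{fE, fF}"]
  unfolding verts_def by auto

lemma vert_subset: "v \<in> verts F \<Longrightarrow> v \<subseteq> D"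
  unfolding verts_def by (rule orbits_subset)

lemma card_vert: "v \<in> verts F \<Longrightarrow> card v = 8"
proof -
  assume v: "v \<in> verts F"
  have fin: "finite v" using vert_subset[OF v] finite_flags by (rule finite_subset)
  have inD: "x \<in> D" if "x \<in> v" for x using vert_subset[OF v] that by blast
  have U: "\<Union>(half_edge F ` v) = v" using vert_closed[OF v] unfolding half_edge_def by auto
  have "2 * card (half_edge F ` v) = card (\<Union>(half_edge F ` v))"
  proof (rule card_partition)
    show "finite (half_edge F ` v)" using fin by simp
    show "finite (\<Union>(half_edge F ` v))" using U fin by simp
    show "card c = 2" if c: "c \<in> half_edge F ` v" for c
    proof -
      obtain x where x: "x \<in> v" "c = {x, fF x}" using c unfolding half_edge_def by blast
      have "x \<noteq> fF x" using flip_neq(3)[OF inD[OF x(1)]] by metis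
      then show ?thesis using x by simp
    qed
    show "c \<inter> c' = {}" if c: "c \<in> half_edge F ` v" "c' \<in> half_edge F ` v" "c \<noteq> c'" for c c'
    proof (rule ccontr)
      obtain x y where xy: "x \<in> v" "c = {x, fF x}" "y \<in> v" "c' = {y, fF y}"
        using c unfolding half_edge_def by blast
      assume "c \<inter> c' \<noteq> {}"
      then have "x = y \<or> x = fF y \<or> fF x = y \<or> fF x = fF y" using xy by blast
      then have "c = c'" using xy inD flip_flip(3) by (metis insert_commute)
      then show False using c by blast
    qed
  qed
  moreover have "card (half_edge F ` v) = 4"
    using four_regular v unfolding four_regular_def degree_def by blast
  ultimately show "card v = 8" using U by simp
qed

lemma vert_orbit: "v \<in> verts F \<Longrightarrow> x \<in> v \<Longrightarrow> x \<in> S \<Longrightarrow>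
  (\<And>y. y \<in> S \<Longrightarrow> fE y \<in> S \<and> fF y \<in> S) \<Longrightarrow> v \<subseteq> S"
proof (rule conn_class_subset)
  assume "v \<in> verts F" then show "v \<in> conn_classes D (arcs D {fE, fF})"
    by (simp add: verts_def orbits_def)
  assume cl: "\<And>y. y \<in> S \<Longrightarrow> fE y \<in> S \<and> fF y \<in> S"
  show "x \<in> S \<longleftrightarrow> y \<in> S" if "(x, y) \<in> arcs D {fE, fF}" for x y
    using that cl[of x] cl[of y] flip_flip(2,3)[of x] unfolding mem_arcs2 by metis
qed

text \<open>
  The eight flags at a vertex form a cycle along which \<open>fE\<close> and \<open>fF\<close> alternate; it would be
  shorter if the two involutions \<open>fE\<close> and \<open>fG\<close> of its four flags in \<open>C\<close> agreed somewhere.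
\<close>

lemma coloured_corner:
  assumes v: "v \<in> verts F" and x: "x \<in> v" "x \<in> \<Union>C"
  shows "v \<inter> \<Union>C = {x, fE x, fG x, fE (fG x)}" "fG (fE x) = fE (fG x)" "fG x \<noteq> fE x"
    "card (v \<inter> \<Union>C) = 4"
proof -
  have inD: "y \<in> D" if "y \<in> v" for y using vert_subset[OF v] that by blast
  have fin: "finite v" using vert_subset[OF v] finite_flags by (rule finite_subset)
  have xD: "x \<in> D" by (rule inD[OF x(1)])
  \<comment> \<open>Passing to the other side of a half-edge changes the colour, so the eight flags
    at \<open>v\<close> split evenly.\<close>
  have bal: "card (v \<inter> \<Union>C) = card (v - \<Union>C)"
    by (rule card_balanced[where g = fF]) (use fin vert_closed[OF v] inD flip_colour(3) in \<open>simp_all del: Union_iff\<close>)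
  then show c4: "card (v \<inter> \<Union>C) = 4"
    using card_vert[OF v] card_Int_Diff[OF fin, of "\<Union>C"] by simp
  have Q: "fE y \<in> v \<inter> \<Union>C \<and> fG y \<in> v \<inter> \<Union>C" if "y \<in> v \<inter> \<Union>C" for y
    using that vert_closed[OF v] flip_colour inD by (simp del: Union_iff)
  have G2: "fG (fG y) = y" if "y \<in> D" for y using that by simp
  have G_neq: "fG y \<noteq> y" if y: "y \<in> D" for y
    using y flip_neq(2)[of "fF y"] flip_flip(3)[of "fE (fF y)"] by (metis flip_in(2,3))
  show ne: "fG x \<noteq> fE x"
  proof
    assume eq: "fG x = fE x"
    let ?S = "{x, fE x, fF x, fF (fE x)}"
    have 1: "fE (fF x) = fF (fE x)" using eq xD by (metis flip_flip(3) flip_in(2,3))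
    have 2: "fE (fF (fE x)) = fF x" using 1 xD by (metis flip_flip(2) flip_in(3))
    have "v \<subseteq> ?S"
      by (rule vert_orbit[OF v x(1)]) (use 1 2 xD in auto)
    moreover have "card ?S \<le> 4" by (intro order_trans[OF card_insert_le_m1]) auto
    ultimately show False using card_mono[of ?S v] card_vert[OF v] by simp
  qed
  have EG_neq: "fE (fG x) \<noteq> x" "fE (fG x) \<noteq> fE x" "fE (fG x) \<noteq> fG x"
    using ne G_neq[OF xD] xD flip_flip(2) flip_neq(2) flip_in by metis+
  let ?Q = "{x, fE x, fG x, fE (fG x)}"
  have "x \<noteq> fE x" "x \<noteq> fG x" using G_neq[OF xD] flip_neq(2)[OF xD] by metis+
  then have "card ?Q = 4" using ne EG_neq by (auto simp: card_insert_if)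
  moreover have "?Q \<subseteq> v \<inter> \<Union>C" using x Q by blast
  ultimately show eq: "v \<inter> \<Union>C = ?Q"
    using c4 card_subset_eq[of "v \<inter> \<Union>C" ?Q] fin by simp
  \<comment> \<open>\<open>fG (fE x)\<close> lies in the four-element set \<open>?Q\<close>;
    excluding three members leaves \<open>fE (fG x)\<close>.\<close>
  have "fG (fE x) \<noteq> fE x" using G_neq xD by simp
  moreover have "fG (fE x) \<noteq> fG x" using G2[of x] G2[of "fE x"] xD flip_neq(2)[OF xD] flip_in by metis
  moreover have "fG (fE x) \<noteq> x" using ne G2[of "fE x"] xD flip_in by metis
  ultimately show "fG (fE x) = fE (fG x)" using Q[of "fE x"] Q[of x] x eq by blast
qed

lemma ex_vert: "x \<in> D \<Longrightarrow> \<exists>v \<in> verts F. x \<in> v"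
  unfolding verts_def by (rule orbit_ex)

text \<open>The commutation and distinctness of the new \<open>flipV\<close> and
  \<open>flipF\<close> come from the cycle of eight flags at a vertex; the involution properties are
  inherited from \<open>F\<close>.\<close>

lemma embedded_T: "embedded T"
proof
  have inv: "fG x \<in> flags T \<and> fG (fG x) = x \<and> fG x \<noteq> x"
    "fE x \<in> flags T \<and> fE (fE x) = x \<and> fE x \<noteq> x"
    "fV x \<in> flags T \<and> fV (fV x) = x \<and> fV x \<noteq> x"
    "fG (fE x) = fE (fG x)" "fG x \<noteq> fE x" if "x \<in> flags T" for x
  proof -
    have x: "x \<in> D" "x \<in> \<Union>C" using that unfolding flags_T by auto
    have "fG x \<noteq> x"
      using x flip_neq(2)[of "fF x"] flip_flip(3)[of "fE (fF x)"] by (metis flip_in(2,3))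
    then show "fG x \<in> flags T \<and> fG (fG x) = x \<and> fG x \<noteq> x"
      "fE x \<in> flags T \<and> fE (fE x) = x \<and> fE x \<noteq> x"
      "fV x \<in> flags T \<and> fV (fV x) = x \<and> fV x \<noteq> x"
      unfolding flags_T using x flip_colour by (simp_all del: Union_iff)
    obtain v where v: "v \<in> verts F" "x \<in> v" using ex_vert[OF x(1)] by blast
    show "fG (fE x) = fE (fG x)" "fG x \<noteq> fE x" by (rule coloured_corner[OF v x(2)])+
  qed
  have "finite (flags T)" by (simp add: flags_T)
  then show "embedded_graph T"
    unfolding embedded_graph_def using inv by (simp add: flips_T)
qed

text \<open>\<open>fG\<close> is a product of three flips, an odd number, so the signs of
  \<open>F\<close> still work.\<close>

lemma orientable_T: "orientable F \<Longrightarrow> orientable T"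
proof -
  assume "orientable F"
  then obtain pos where "\<forall>g \<in> {fV, fE, fF}. \<forall>x \<in> D. g x \<in> pos \<longleftrightarrow> x \<notin> pos"
    unfolding orientable_def by blast
  then have "\<forall>g \<in> {flipV T, fV, fE}. \<forall>x \<in> flags T. g x \<in> pos \<longleftrightarrow> x \<notin> pos"
    unfolding flags_T by (simp add: flips_T)
  then show ?thesis unfolding orientable_def flips_T by blast
qed

lemma vert_Int_nonempty: "v \<in> verts F \<Longrightarrow> \<exists>x \<in> v. x \<in> \<Union>C"
proof -
  assume v: "v \<in> verts F"
  have "v \<noteq> {}" using v conn_classes_nonempty unfolding verts_def orbits_def by blast
  then obtain x where x: "x \<in> v" by blast
  then show ?thesis
    using vert_closed[OF v x] flip_colour(3)[of x] vert_subset[OF v] by blast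
qed

lemma vert_Int_flags_T: "v \<in> verts F \<Longrightarrow> v \<inter> flags T = v \<inter> \<Union>C"
  using vert_subset unfolding flags_T by blast

text \<open>The black or white flags at a vertex, as listed in \<open>coloured_corner\<close>, are
  precisely the four flags that \<open>edge_flags\<close> gives for an edge of
  \<open>T\<close>.\<close>

lemma edges_through_subset:
  assumes "X \<subseteq> verts F"
  shows "edges_through T X \<subseteq> edges T"
proof
  interpret T: embedded T by (rule embedded_T)
  fix e assume "e \<in> edges_through T X"
  then obtain v where v: "v \<in> verts F" "e = v \<inter> \<Union>C"
    unfolding edges_through_def using vert_Int_flags_T assms by auto
  obtain x where x: "x \<in> v" "x \<in> \<Union>C" using vert_Int_nonempty[OF v(1)] by blast
  have "x \<in> flags T" using x vert_subset[OF v(1)] unfolding flags_T by blast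
  then obtain e' where e': "e' \<in> edges T" "x \<in> e'"
    using orbit_ex[of x "flags T"] unfolding edges_def by blast
  have "e' = {x, fE x, fG x, fE (fG x)}"
    using T.edge_flags(1)[OF e'] unfolding flips_T .
  then have "e' = e" using coloured_corner(1)[OF v(1) x] v(2) by simp
  then show "e \<in> edges T" using e' by simp
qed

lemma card_edges_through:
  assumes "X \<subseteq> verts F"
  shows "card (edges_through T X) = card X"
  unfolding edges_through_def
proof (rule card_image, rule inj_onI)
  fix v w assume vw: "v \<in> X" "w \<in> X" "v \<inter> flags T = w \<inter> flags T"
  then have "v \<inter> \<Union>C = w \<inter> \<Union>C" "v \<in> verts F" "w \<in> verts F"
    using vert_Int_flags_T assms by auto
  moreover then obtain x where "x \<in> v \<inter> \<Union>C" using vert_Int_nonempty by blast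
  ultimately show "v = w"
    using orbits_eqI[of v D "{fE, fF}" w x] unfolding verts_def by blast
qed

lemma Union_edges_through: "\<Union>(edges_through T X) = \<Union>X \<inter> flags T"
  unfolding edges_through_def by blast

lemma boundary_comps_T:
  "boundary_comps T (edges_through T X) = conn_classes (flags T) (arcs (flags T) {fV, turn X})"
  unfolding boundary_comps_def orbits_def Union_edges_through flips_T
  by (rule arg_cong[OF arcs2_cong]) (simp add: turn_def flips_T)

lemma subgraph_comps_T:
  "subgraph_comps T (edges_through T X) =
    conn_classes (flags T) (arcs (flags T) {fV, fE, ribbons X})"
  unfolding subgraph_comps_def orbits_def Union_edges_through flips_T
  by (rule arg_cong[OF arcs3_cong]) (simp add: ribbons_def flips_T)

lemma verts_T: "verts T = conn_classes (flags T) (arcs (flags T) {fV, fE})"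
  unfolding verts_def orbits_def flips_T ..

lemma flip_in_T: "x \<in> flags T \<Longrightarrow> fV x \<in> flags T" "x \<in> flags T \<Longrightarrow> fE x \<in> flags T"
  "x \<in> flags T \<Longrightarrow> fG x \<in> flags T"
  using flip_colour unfolding flags_T by (simp_all del: Union_iff)

lemma card_flags_eq_verts: "card D = 8 * card (verts F)"
  unfolding verts_def by (rule card_eq_mult_card_orbits) (use card_vert in \<open>auto simp: verts_def\<close>)

lemma card_flags_eq_edges: "card D = 4 * card (edges F)"
  unfolding edges_def
proof (rule card_eq_mult_card_orbits)
  fix e assume e: "e \<in> orbits D {fV, fF}"
  then obtain a where "a \<in> e" using conn_classes_nonempty unfolding orbits_def by blast
  then show "card e = 4" using edge_flags[of e a] e unfolding edges_def by auto
qed simp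

text \<open>Eight flags per vertex and four per edge make twice as many edges as vertices.\<close>

lemma euler_char_eq: "euler_char F = int (card (faces F)) - int (card (verts F))"
  using card_flags_eq_verts card_flags_eq_edges unfolding euler_char_def by simp

end

section \<open>The two complementary ribbon subgraphs and their gluing\<close>

locale tait = coloured F black for F :: "'f flag_graph" and black +
  fixes W B :: "'f set set"
  assumes connected: "connected_graph F"
    and WB: "W \<union> B = verts F" "W \<inter> B = {}"
begin

interpretation white: coloured F "faces F - black"
  by (rule coloured_complement)

lemma flags_split: "flags T \<union> flags white.T = D" "flags T \<inter> flags white.T = {}"
  unfolding flags_T white.flags_T using complement_colour by blast+

lemma fF_other: "x \<in> flags T \<Longrightarrow> fF x \<in> flags white.T" "x \<in> flags white.T \<Longrightarrow> fF x \<in> flags T"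
  unfolding flags_T white.flags_T using complement_colour flip_colour(3) flip_in(3) by blast+

lemma T_in_D: "x \<in> flags T \<Longrightarrow> x \<in> D" "x \<in> flags white.T \<Longrightarrow> x \<in> D"
  by (simp_all add: flags_T white.flags_T)

lemma mem_B_iff: "x \<in> D \<Longrightarrow> x \<in> \<Union>B \<longleftrightarrow> x \<notin> \<Union>W"
  using ex_vert[of x] WB orbits_eqI[of _ D "{fE, fF}" _ x] unfolding verts_def by blast

lemma mem_W_fF: "x \<in> D \<Longrightarrow> fF x \<in> \<Union>W \<longleftrightarrow> x \<in> \<Union>W"
proof -
  assume x: "x \<in> D"
  have cl: "fF y \<in> \<Union>W" if "y \<in> \<Union>W" for y using that WB(1) vert_closed by blast
  show ?thesis using cl[of x] cl[of "fF x"] unfolding flip_flip(3)[OF x] by blast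
qed

text \<open>
  Along a half-edge of a state curve, \<open>fF\<close> passes from the black to the white side, and it commutes
  with the moves along the boundaries of the two ribbon subgraphs.
\<close>

lemma turn_fF: "x \<in> D \<Longrightarrow> turn B (fF x) = fF (turn W x)" "x \<in> D \<Longrightarrow> turn W (fF x) = fF (turn B x)"
  unfolding turn_def using mem_B_iff[of x] mem_B_iff[of "fF x"] mem_W_fF[of x]
  by (simp_all del: Union_iff)

text \<open>At each vertex of \<open>F\<close> exactly one of the two crossing ribbons is kept, so
  both boundaries follow the same curves, and \<open>fF\<close> exchanges the two sides of each
  curve.\<close>

lemma card_boundary_comps_dual:
  "card (boundary_comps white.T (edges_through white.T B)) =
    card (boundary_comps T (edges_through T W))"
  unfolding boundary_comps_T white.boundary_comps_T
proof (rule card_conn_classes_transport[where h = fF and k = fF])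
  show "fF ` flags white.T \<subseteq> flags T" "fF ` flags T \<subseteq> flags white.T" using fF_other by blast+
  show "fF (fF x) = x" if "x \<in> flags white.T" for x using T_in_D that by simp
  show "fF (fF x) = x" if "x \<in> flags T" for x using T_in_D that by simp
  show "(fF x, fF y) \<in> conn (flags T) (arcs (flags T) {fV, turn W})"
    if xy: "(x, y) \<in> arcs (flags white.T) {fV, turn B}" "x \<in> flags white.T" "y \<in> flags white.T" for x y
  proof (rule conn_edge)
    show "(fF x, fF y) \<in> arcs (flags T) {fV, turn W}"
      using xy fF_other turn_fF[of x] flipV_flipF[of x] T_in_D unfolding mem_arcs2 by auto
  qed (use xy fF_other in auto)
  show "(fF x, fF y) \<in> conn (flags white.T) (arcs (flags white.T) {fV, turn B})"
    if xy: "(x, y) \<in> arcs (flags T) {fV, turn W}" "x \<in> flags T" "y \<in> flags T" for x y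
  proof (rule conn_edge)
    show "(fF x, fF y) \<in> arcs (flags white.T) {fV, turn B}"
      using xy fF_other turn_fF[of x] flipV_flipF[of x] T_in_D unfolding mem_arcs2 by auto
  qed (use xy fF_other in auto)
qed

text \<open>\<open>fV\<close> and \<open>fE\<close> stay within a face, so the face orbits separate
  by colour into the vertices of the two face graphs.\<close>

lemma card_verts_T: "card (verts T) + card (verts white.T) = card (faces F)"
proof -
  let ?b = "arcs (flags T) {fV, fE}" and ?w = "arcs (flags white.T) {fV, fE}"
  have eq: "arcs D {fV, fE} = ?b \<union> ?w" unfolding flags_split(1)[symmetric] by blast
  have "card (conn_classes (flags T \<union> flags white.T) (?b \<union> ?w)) =
    card (conn_classes (flags T) ?b) + card (conn_classes (flags white.T) ?w)"
  proof (rule card_conn_classes_disjoint_Un)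
    show "x \<in> flags T \<and> y \<in> flags T" if "(x, y) \<in> ?b" for x y
      using that flip_in_T[of x] unfolding mem_arcs2 by auto
    show "x \<in> flags white.T \<and> y \<in> flags white.T" if "(x, y) \<in> ?w" for x y
      using that white.flip_in_T[of x] unfolding mem_arcs2 by auto
  qed (simp_all add: flags_split(2), simp_all add: flags_T white.flags_T)
  then have "card (conn_classes D (?b \<union> ?w)) = card (verts T) + card (verts white.T)"
    unfolding flags_split(1) verts_T white.verts_T .
  moreover have "faces F = conn_classes D (arcs D {fV, fE})"
    unfolding faces_def orbits_def by (rule refl)
  then have "faces F = conn_classes D (?b \<union> ?w)"
    by (rule trans[OF _ arg_cong[OF eq]])
  ultimately show ?thesis by metis
qed

text \<open>
  Cutting the surface along the state curves leaves the two ribbon subgraphs, and one flag pair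
  per curve suffices to glue them together again.
\<close>

lemma card_subgraph_comps_le:
  "card (subgraph_comps T (edges_through T W)) + card (subgraph_comps white.T (edges_through white.T B))
    \<le> Suc (card (boundary_comps T (edges_through T W)))"
proof -
  let ?b = "arcs (flags T) {fV, fE, ribbons W}" and ?w = "arcs (flags white.T) {fV, fE, ribbons B}"
  let ?bd = "boundary_comps T (edges_through T W)"
  \<comment> \<open>One flag is chosen on each curve; the arc from it to its mirror image under
    \<open>fF\<close> glues the two sides.\<close>
  define p where "p = (\<lambda>\<beta>. SOME x. x \<in> (\<beta> :: 'f set))"
  define glue where "glue = (\<lambda>\<beta>. (p \<beta>, fF (p \<beta>))) ` ?bd"
  let ?r = "?b \<union> ?w \<union> glue"
  have fin: "finite ?bd" unfolding boundary_comps_T by (rule finite_conn_classes) (simp add: flags_T)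
  have sum: "card (conn_classes D (?b \<union> ?w)) =
    card (subgraph_comps T (edges_through T W)) + card (subgraph_comps white.T (edges_through white.T B))"
    unfolding subgraph_comps_T white.subgraph_comps_T flags_split(1)[symmetric]
  proof (rule card_conn_classes_disjoint_Un)
    show "x \<in> flags T \<and> y \<in> flags T" if "(x, y) \<in> ?b" for x y
      using that flip_in_T[of x] unfolding mem_arcs3 ribbons_def by auto
    show "x \<in> flags white.T \<and> y \<in> flags white.T" if "(x, y) \<in> ?w" for x y
      using that white.flip_in_T[of x] unfolding mem_arcs3 ribbons_def by auto
  qed (simp_all add: flags_split(2), simp_all add: flags_T white.flags_T)
  have "card (conn_classes D (?b \<union> ?w)) \<le> card (conn_classes D ?r) + card glue"
    by (rule card_conn_classes_le_Un) (simp_all add: glue_def fin)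
  moreover have "card glue \<le> card ?bd" unfolding glue_def by (rule card_image_le[OF fin])
  moreover have "card (conn_classes D ?r) \<le> 1"
  proof -
    have move: "(x, fV x) \<in> conn D ?r" "(x, fE x) \<in> conn D ?r" if x: "x \<in> D" for x
      by (rule conn_edge; use x flags_split(1) in \<open>auto simp: mem_arcs3\<close>)+
    have turn_b: "(x, turn W x) \<in> conn D ?r" if x: "x \<in> flags T" for x
    proof (rule conn_edge)
      show "(x, turn W x) \<in> ?r" using x unfolding Un_iff mem_arcs3 turn_def ribbons_def by simp
    qed (use T_in_D[of x] x in \<open>simp_all add: turn_def\<close>)
    have turn_w: "(x, turn B x) \<in> conn D ?r" if x: "x \<in> flags white.T" for x
    proof (rule conn_edge)
      show "(x, turn B x) \<in> ?r" using x unfolding Un_iff mem_arcs3 turn_def ribbons_def by simp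
    qed (use T_in_D[of x] x in \<open>simp_all add: turn_def\<close>)
    have black: "(x, fF x) \<in> conn D ?r" if x: "x \<in> flags T" for x
    proof -
      have "x \<in> \<Union>?bd" unfolding boundary_comps_T Union_conn_classes by (rule x)
      then obtain \<beta> where \<beta>: "\<beta> \<in> ?bd" "x \<in> \<beta>" by blast
      then have p: "p \<beta> \<in> \<beta>" unfolding p_def by (metis someI)
      have "\<beta> \<subseteq> \<Union>?bd" using \<beta>(1) by (rule Union_upper)
      then have "\<beta> \<subseteq> flags T" unfolding boundary_comps_T Union_conn_classes .
      then have pD: "p \<beta> \<in> D" using p T_in_D by blast
      \<comment> \<open>Being connected to the mirror image holds at \<open>p \<beta>\<close> by
        \<open>glue\<close>. It spreads along the curve because \<open>fF\<close> turns each black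
        boundary move into a white one, and both moves stay within their pieces.\<close>
      have "\<beta> \<subseteq> {y. (y, fF y) \<in> conn D ?r}"
      proof (rule conn_class_subset)
        show "\<beta> \<in> conn_classes (flags T) (arcs (flags T) {fV, turn W})"
          using \<beta>(1) unfolding boundary_comps_T .
        show "p \<beta> \<in> \<beta>" by (rule p)
        show "p \<beta> \<in> {y. (y, fF y) \<in> conn D ?r}"
          using \<beta>(1) pD by (auto simp: glue_def intro!: conn_edge)
        fix y z assume yz: "(y, z) \<in> arcs (flags T) {fV, turn W}"
        then have y: "y \<in> flags T" "y \<in> D" "z = fV y \<or> z = turn W y"
          using T_in_D by blast+
        have "(y, z) \<in> conn D ?r" using y turn_b move by blast
        moreover have "(fF y, fF z) \<in> conn D ?r"
          using y(3) turn_fF[OF y(2)] turn_w[OF fF_other(1)[OF y(1)]] move(1)[of "fF y"] y(2)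
            flipV_flipF[OF y(2)] by auto
        ultimately show "y \<in> {y. (y, fF y) \<in> conn D ?r} \<longleftrightarrow> z \<in> {y. (y, fF y) \<in> conn D ?r}"
          unfolding mem_Collect_eq by (meson conn_sym conn_trans)
      qed
      then show ?thesis using \<beta>(2) by blast
    qed
    have flipF: "(x, fF x) \<in> conn D ?r" if x: "x \<in> D" for x
    proof (cases "x \<in> flags T")
      case False
      then have "fF x \<in> flags T" using x flags_split fF_other by blast
      then show ?thesis using black[of "fF x"] x conn_sym by fastforce
    qed (rule black)
    have "conn D (arcs D {fV, fE, fF}) \<subseteq> conn D ?r"
    proof (rule conn_mono)
      show "(x, y) \<in> conn D ?r" if "(x, y) \<in> arcs D {fV, fE, fF}" for x y
        using that move flipF unfolding mem_arcs3 by auto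
    qed
    then have "card (conn_classes D ?r) \<le> card (conn_classes D (arcs D {fV, fE, fF}))"
      by (intro card_conn_classes_antimono) simp_all
    then show ?thesis using connected unfolding connected_graph_def orbits_def by simp
  qed
  ultimately show ?thesis using sum by linarith
qed

text \<open>Since both boundaries have the same number \<open>f\<close> of curves, the sum of the
  genera is twice (number of pieces minus \<open>f\<close>), minus the number of faces, plus the
  number of vertices of \<open>F\<close>. The first difference is at most 1, and the rest is minus
  \<open>euler_char F\<close>.\<close>

lemma euler_genus_sum_le:
  "euler_genus T (edges_through T W) + euler_genus white.T (edges_through white.T B) \<le> 2 - euler_char F"
proof -
  have "finite (verts F)" unfolding verts_def by (simp add: finite_orbits)
  then have "card (verts F) = card W + card B"
    using WB card_Un_disjoint[of W B] by (metis finite_Un)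
  moreover have "card (edges_through T W) = card W" "card (edges_through white.T B) = card B"
    using WB(1) by (auto intro!: card_edges_through white.card_edges_through)
  ultimately show ?thesis
    using card_subgraph_comps_le card_boundary_comps_dual card_verts_T euler_char_eq
    unfolding euler_genus_def by linarith
qed

section \<open>State curves as boundary curves of the black ribbon subgraph\<close>

lemma half_edge_flipF: "x \<in> D \<Longrightarrow> half_edge F (fF x) = half_edge F x"
  unfolding half_edge_def by auto

text \<open>A half-edge has one flag in a black face and one in a white face, so sending it to its
  black flag (the map \<open>k\<close>) is a bijection onto the flags of \<open>T\<close>. Seen from
  the black side, a black split is the step \<open>fE\<close> and a white split is the step
  \<open>fG\<close> around the neighbouring white corner; together these are
  \<open>turn W\<close>.\<close>

lemma card_state_comps:
  assumes s: "\<forall>v \<in> verts F. s v \<noteq> Crossing"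
    and B: "B = {v \<in> verts F. s v = Black_Split}" and W: "W = {v \<in> verts F. s v = White_Split}"
  shows "card (state_comps F black s) = card (boundary_comps T (edges_through T W))"
proof -
  let ?he = "half_edge F"
  let ?H = "?he ` D"
  let ?r = "{(?he x, ?he (fV x)) | x. x \<in> D} \<union> (\<Union>v \<in> verts F. state_pairing F black v (s v))"
  let ?a = "arcs (flags T) {fV, turn W}"
  define k where "k = (\<lambda>h. SOME x. x \<in> h \<and> x \<in> \<Union>black)"
  have k: "k (?he x) = (if x \<in> flags T then x else fF x)" if x: "x \<in> D" for x
    unfolding k_def
  proof (rule some_equality)
    show "(if x \<in> flags T then x else fF x) \<in> ?he x \<and> (if x \<in> flags T then x else fF x) \<in> \<Union>black"
      using x flip_colour(3)[OF x] unfolding half_edge_def flags_T by (simp del: Union_iff)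
    show "y = (if x \<in> flags T then x else fF x)" if "y \<in> ?he x \<and> y \<in> \<Union>black" for y
      using that x flip_colour(3)[OF x] unfolding half_edge_def flags_T by (auto simp del: Union_iff)
  qed
  have k_in: "k h \<in> flags T" if h: "h \<in> ?H" for h
  proof -
    obtain x where x: "x \<in> D" "h = ?he x" using h by blast
    show ?thesis
    proof (cases "x \<in> flags T")
      case True
      then show ?thesis using x k by simp
    next
      case False
      then have "x \<in> flags white.T" using x(1) flags_split(1) by blast
      then show ?thesis using False x k fF_other(2) by simp
    qed
  qed
  have step: "(?he x, ?he (turn W x)) \<in> ?r" if x: "x \<in> flags T" for x
  proof -
    have xD: "x \<in> D" "x \<in> \<Union>black" using x unfolding flags_T by blast+
    obtain v where v: "v \<in> verts F" "x \<in> v" using ex_vert[OF xD(1)] by blast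
    have vW: "x \<in> \<Union>W \<longleftrightarrow> s v = White_Split"
      using v s mem_B_iff[OF xD(1)] unfolding W B by (cases "s v") auto
    have "(?he x, ?he (turn W x)) \<in> state_pairing F black v (s v)"
    proof (cases "x \<in> \<Union>W")
      case True
      then have "turn W x = fG x" unfolding turn_def by simp
      moreover have "?he (fF x) = ?he x" "?he (fG x) = ?he (fE (fF x))"
        using half_edge_flipF xD(1) by simp_all
      moreover have "fF x \<in> v" "fF x \<in> \<Union>(faces F - black)"
        using vert_closed[OF v] xD flip_colour(3) complement_colour[of "fF x"] by (simp_all del: Union_iff)
      \<comment> \<open>White splits are listed by white flags, so the witness is
        \<open>fF x\<close>, the white flag of the same half-edge.\<close>
      ultimately have "\<exists>y. (?he x, ?he (turn W x)) = (?he y, ?he (fE y)) \<and> y \<in> v \<and> y \<in> \<Union>(faces F - black)"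
        by (intro exI[of _ "fF x"]) (simp del: Union_iff)
      then show ?thesis using True vW by simp
    next
      case False
      then have "s v = Black_Split" "turn W x = fE x"
        using vW s v(1) unfolding turn_def by (cases "s v"; auto)+
      then show ?thesis using v xD by auto
    qed
    then show ?thesis using v(1) by blast
  qed
  have unstep: "(k g, k h) \<in> ?a" if gh: "(g, h) \<in> ?r" for g h
  proof -
    consider x where "x \<in> D" "g = ?he x" "h = ?he (fV x)"
      | v where "v \<in> verts F" "(g, h) \<in> state_pairing F black v (s v)"
      using gh by blast
    then show ?thesis
    proof cases
      case 1
      then have "k h = fV (k g)" "k g \<in> flags T"
        using k[of x] k[of "fV x"] flip_colour(1)[of x] flip_colour(3)[of x] flipV_flipF[of x]
        unfolding flags_T by (simp_all del: Union_iff)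
      then show ?thesis unfolding mem_arcs2 by simp
    next
      case 2
      have vD: "x \<in> D" if "x \<in> v" for x using that vert_subset[OF 2(1)] by blast
      show ?thesis
      proof (cases "s v")
        case Black_Split
        then obtain x where x: "x \<in> v" "x \<in> \<Union>black" "g = ?he x" "h = ?he (fE x)"
          using 2(2) by auto
        have xD: "x \<in> D" by (rule vD[OF x(1)])
        have "x \<in> \<Union>B" using 2(1) x(1) Black_Split unfolding B by blast
        then have "turn W x = fE x" using mem_B_iff[OF xD] unfolding turn_def by simp
        moreover have "x \<in> flags T" "fE x \<in> flags T" using x xD flip_in_T(2) unfolding flags_T by blast+
        ultimately show ?thesis using k[of x] k[of "fE x"] x xD unfolding mem_arcs2 by simp
      next
        case White_Split
        then obtain x where x: "x \<in> v" "x \<in> \<Union>(faces F - black)" "g = ?he x" "h = ?he (fE x)"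
          using 2(2) by auto
        have xD: "x \<in> D" by (rule vD[OF x(1)])
        have "x \<in> \<Union>W" using 2(1) x(1) White_Split unfolding W by blast
        then have "turn W (fF x) = fF (fE x)" using mem_W_fF[OF xD] xD unfolding turn_def by simp
        moreover have xw: "x \<in> flags white.T" using x xD unfolding white.flags_T by blast
        then have "x \<notin> flags T" "fE x \<notin> flags T" "fF x \<in> flags T"
          using flags_split(2) white.flip_in_T(2) fF_other(2) by blast+
        ultimately show ?thesis using k[of x] k[of "fE x"] x xD unfolding mem_arcs2 by simp
      next
        case Crossing
        then show ?thesis using s 2(1) by blast
      qed
    qed
  qed
  have "card (conn_classes (flags T) ?a) = card (conn_classes ?H ?r)"
  proof (rule card_conn_classes_transport[where h = ?he and k = k])
    show "?he ` flags T \<subseteq> ?H" unfolding flags_T by blast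
    show "k ` ?H \<subseteq> flags T" using k_in by blast
    show "k (?he x) = x" if "x \<in> flags T" for x using that k T_in_D by simp
    show "?he (k h) = h" if h: "h \<in> ?H" for h
    proof -
      obtain x where x: "x \<in> D" "h = ?he x" using h by blast
      then show ?thesis using k[OF x(1)] half_edge_flipF[OF x(1)] by (cases "x \<in> flags T") simp_all
    qed
    show "(?he x, ?he y) \<in> conn ?H ?r"
      if xy: "(x, y) \<in> ?a" "x \<in> flags T" "y \<in> flags T" for x y
    proof (rule conn_edge)
      show "(?he x, ?he y) \<in> ?r"
      proof (cases "y = fV x")
        case True
        then show ?thesis using T_in_D(1)[OF xy(2)] by blast
      next
        case False
        then have "y = turn W x" using xy(1) unfolding mem_arcs2 by simp
        then show ?thesis using step[OF xy(2)] by (simp only:)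
      qed
    qed (use xy T_in_D in blast)+
    show "(k g, k h) \<in> conn (flags T) ?a" if "(g, h) \<in> ?r" "g \<in> ?H" "h \<in> ?H" for g h
    proof (rule conn_edge[OF unstep[OF that(1)]])
      show "k g \<in> flags T" "k h \<in> flags T" using that(2,3) by (simp_all only: k_in)
    qed
  qed
  then show ?thesis unfolding state_comps_def boundary_comps_T by simp
qed

lemma min_euler_genus:
  assumes "in_sphere F \<or> in_torus F \<or> in_projective_plane F"
  shows "min (euler_genus white.T (edges_through white.T B)) (euler_genus T (edges_through T W)) = 0"
    (is "min ?g' ?g = 0")
proof -
  have sub: "edges_through T W \<subseteq> edges T" "edges_through white.T B \<subseteq> edges white.T"
    using WB(1) by (blast intro!: edges_through_subset white.edges_through_subset)+
  have nonneg: "0 \<le> ?g" "0 \<le> ?g'"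
    by (rule embedded.euler_genus_nonneg[OF embedded_T sub(1)]
        embedded.euler_genus_nonneg[OF white.embedded_T sub(2)])+
  show ?thesis
  proof (cases "orientable F")
    case True
    then have "even ?g" "even ?g'"
      using embedded.even_euler_genus[OF embedded_T sub(1) orientable_T]
        embedded.even_euler_genus[OF white.embedded_T sub(2) white.orientable_T] by blast+
    \<comment> \<open>The bound is 0 on the sphere and 2 on the torus; two positive even genera
      would already sum to 4.\<close>
    moreover have "?g + ?g' \<le> 2"
      using True assms euler_genus_sum_le
      unfolding in_sphere_def in_torus_def in_projective_plane_def by auto
    ultimately show ?thesis using nonneg by presburger
  next
    case False
    \<comment> \<open>Only the projective plane is left, and two positive genera would sum to at
      least 2.\<close>
    then have "?g + ?g' \<le> 1"
      using assms euler_genus_sum_le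
      unfolding in_sphere_def in_torus_def in_projective_plane_def by auto
    then show ?thesis using nonneg by linarith
  qed
qed

end

theorem theorem6p4:
  fixes F F_bl F_wh :: "'f flag_graph"
    and black B W :: "'f set set"
    and s :: "'f set \<Rightarrow> vertex_state"
  assumes "embedded_graph F"
    and "connected_graph F"
    and "four_regular F"
    and "checkerboard F black"
    and "in_sphere F \<or> in_torus F \<or> in_projective_plane F"
    and "\<forall>v \<in> verts F. s v \<noteq> Crossing"
    and "F_bl = blackface_graph F black"
    and "F_wh = whiteface_graph F black"
    and "B = {v \<in> verts F. s v = Black_Split}"
    and "W = {v \<in> verts F. s v = White_Split}"
  shows "int (card (state_comps F black s)) =
    min (int (card (boundary_comps F_bl (edges_through F_bl W)))
           + euler_genus F_wh (edges_through F_wh B))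
        (int (card (boundary_comps F_bl (edges_through F_bl W)))
           + euler_genus F_bl (edges_through F_bl W))"
proof -
  have WB: "W \<union> B = verts F" "W \<inter> B = {}"
    using assms(6,9,10) vertex_state.exhaust by auto
  have tait: "tait F black W B"
    by (intro tait.intro tait_axioms.intro coloured.intro coloured_axioms.intro embedded.intro)
      (fact assms(1-4) WB)+
  show ?thesis
    unfolding assms(7,8) blackface_graph_def whiteface_graph_def
    \<comment> \<open>Both arguments of \<open>min\<close> share the boundary count, which is the
      number of state curves, and the smaller genus is 0.\<close>
    using tait.min_euler_genus[OF tait assms(5)] tait.card_state_comps[OF tait assms(6,9,10)]
    by linarith
qed

end
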